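(* Let $p(\cdot)\in\mathcal{P}(\mathbb{R})$ satisfy at least one of: $p_+<\infty$; or $1/p(\cdot)$ is log-Hölder continuous at infinity with limit $1$ (i.e. there is $C>0$ with $\left|\frac{1}{p(x)}-1\right|\le \frac{C}{\log(e+|x|)}$ for almost every $x\in\mathbb{R}$). (1) Define $\mathcal{B}_{p(\cdot)}(\mathbb{R})=\{\Psi_f : f\in L^{p(\cdot)}(\mathbb{R})\}$, and for $f\in L^{p(\cdot)}(\mathbb{R})$ let $\|\Psi_f\|_{\mathcal{B}_{p(\cdot)}(\mathbb{R})}:=\|f\|_{p(\cdot)}$. Then $\left(\mathcal{B}_{p(\cdot)}(\mathbb{R}),\|\cdot\|_{\mathcal{B}_{p(\cdot)}(\mathbb{R})}\right)$ is a Banach space isometrically isomorphic to $L^{p(\cdot)}(\mathbb{R})$. (2) Define $\mathcal{A}_{p(\cdot)}(\mathbb{R})=\{\Psi_f' : f\in L^{p(\cdot)}(\mathbb{R})\}$, where $'$ denotes the distributional derivative, and for $f\in L^{p(\cdot)}(\mathbb{R})$ let $\|\Psi_f'\|_{\mathcal{A}_{p(\cdot)}(\mathbb{R})}:=\|f\|_{p(\cdot)}$. Then $\left(\mathcal{A}_{p(\cdot)}(\mathbb{R}),\|\cdot\|_{\mathcal{A}_{p(\cdot)}(\mathbb{R})}\right)$ is a Banach space isometrically isomorphic to $L^{p(\cdot)}(\mathbb{R})$.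
   Context: $\mathcal{P}(\mathbb{R})$ is the set of measurable functions $p(\cdot):\mathbb{R}\to[1,\infty]$ (exponent functions), and $p_-=\operatorname{ess\,inf} p$, $p_+=\operatorname{ess\,sup} p$. Convention: $1/\infty=0$. Let $\mathbb{R}_\infty^{p(\cdot)}=\{x: p(x)=\infty\}$. The modular is $\rho_{p(\cdot)}(f)=\int_{\mathbb{R}\setminus \mathbb{R}_\infty^{p(\cdot)}}|f(x)|^{p(x)}dx+\|f\|_{L^\infty(\mathbb{R}_\infty^{p(\cdot)})}\in[0,\infty]$. $L^{p(\cdot)}(\mathbb{R})$ is the space of (complex-valued) Lebesgue measurable functions $f$ on $\mathbb{R}$, identified when equal almost everywhere, with $\rho_{p(\cdot)}(f/\lambda)<\infty$ for some $\lambda>0$, with norm $\|f\|_{p(\cdot)}=\inf\{\lambda>0:\rho_{p(\cdot)}(f/\lambda)\le 1\}$. For $f\in L^{p(\cdot)}(\mathbb{R})$, $\Psi_f(s)=\int_{-\infty}^{\infty}\left(\frac{1-e^{-ist}}{it}\right)f(t)\,dt$ for $s\ne0$ (whenever the integral is well defined), and $\Psi_f(0)=0$. The distributional derivative $\Psi_f'$ acts on Schwartz functions $\varphi\in\mathcal{S}(\mathbb{R})$ by $\langle\Psi_f',\varphi\rangle=-\int_{-\infty}^\infty\Psi_f(s)\varphi'(s)\,ds$. *)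

theory Defs
  imports "HOL-Probability.Essential_Supremum"
begin

section \<open>Complex normed spaces on explicit carriers\<close>

text \<open>The spaces below depend on the exponent function, so they cannot be types with a
  norm class instance; a normed space is a carrier set together with its operations.\<close>

record 'v normed_structure =
  vcarrier :: "'v set"
  vadd :: "'v \<Rightarrow> 'v \<Rightarrow> 'v"
  vzero :: "'v"
  vscale :: "complex \<Rightarrow> 'v \<Rightarrow> 'v"
  vnorm :: "'v \<Rightarrow> real"

definition vdiff :: "('v, 'm) normed_structure_scheme \<Rightarrow> 'v \<Rightarrow> 'v \<Rightarrow> 'v" where
  "vdiff E x y = vadd E x (vscale E (-1) y)"

locale complex_vector_space_on =
  fixes E :: "('v, 'm) normed_structure_scheme"
  assumes add_closed: "\<lbrakk>x \<in> vcarrier E; y \<in> vcarrier E\<rbrakk> \<Longrightarrow> vadd E x y \<in> vcarrier E"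
    and zero_closed: "vzero E \<in> vcarrier E"
    and scale_closed: "x \<in> vcarrier E \<Longrightarrow> vscale E a x \<in> vcarrier E"
    and add_assoc: "\<lbrakk>x \<in> vcarrier E; y \<in> vcarrier E; z \<in> vcarrier E\<rbrakk>
          \<Longrightarrow> vadd E (vadd E x y) z = vadd E x (vadd E y z)"
    and add_commute: "\<lbrakk>x \<in> vcarrier E; y \<in> vcarrier E\<rbrakk> \<Longrightarrow> vadd E x y = vadd E y x"
    and add_zero: "x \<in> vcarrier E \<Longrightarrow> vadd E x (vzero E) = x"
    and add_inverse: "x \<in> vcarrier E \<Longrightarrow> \<exists>y\<in>vcarrier E. vadd E x y = vzero E"
    and scale_add: "\<lbrakk>x \<in> vcarrier E; y \<in> vcarrier E\<rbrakk>
          \<Longrightarrow> vscale E a (vadd E x y) = vadd E (vscale E a x) (vscale E a y)"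
    and add_scale: "x \<in> vcarrier E
          \<Longrightarrow> vscale E (a + b) x = vadd E (vscale E a x) (vscale E b x)"
    and scale_scale: "x \<in> vcarrier E \<Longrightarrow> vscale E a (vscale E b x) = vscale E (a * b) x"
    and scale_one: "x \<in> vcarrier E \<Longrightarrow> vscale E 1 x = x"

locale complex_normed_space_on = complex_vector_space_on +
  assumes norm_nonneg: "x \<in> vcarrier E \<Longrightarrow> 0 \<le> vnorm E x"
    and norm_eq_zero: "x \<in> vcarrier E \<Longrightarrow> vnorm E x = 0 \<longleftrightarrow> x = vzero E"
    and norm_scale: "x \<in> vcarrier E \<Longrightarrow> vnorm E (vscale E a x) = cmod a * vnorm E x"
    and norm_triangle: "\<lbrakk>x \<in> vcarrier E; y \<in> vcarrier E\<rbrakk>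
          \<Longrightarrow> vnorm E (vadd E x y) \<le> vnorm E x + vnorm E y"

locale complex_banach_space_on = complex_normed_space_on +
  assumes complete:
    "\<lbrakk>\<And>n. u n \<in> vcarrier E;
      \<And>e. e > 0 \<Longrightarrow> \<exists>N. \<forall>m\<ge>N. \<forall>n\<ge>N. vnorm E (vdiff E (u m) (u n)) < e\<rbrakk>
     \<Longrightarrow> \<exists>x\<in>vcarrier E. (\<lambda>n. vnorm E (vdiff E (u n) x)) \<longlonglongrightarrow> 0"

definition isometrically_isomorphic ::
  "('v, 'm) normed_structure_scheme \<Rightarrow> ('w, 'n) normed_structure_scheme \<Rightarrow> bool" where
  "isometrically_isomorphic E F \<longleftrightarrow>
     (\<exists>T. bij_betw T (vcarrier E) (vcarrier F) \<and>
          (\<forall>x\<in>vcarrier E. \<forall>y\<in>vcarrier E. T (vadd E x y) = vadd F (T x) (T y)) \<and>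
          (\<forall>a. \<forall>x\<in>vcarrier E. T (vscale E a x) = vscale F a (T x)) \<and>
          (\<forall>x\<in>vcarrier E. vnorm F (T x) = vnorm E x))"

definition pointwise_space ::
  "('x \<Rightarrow> complex) set \<Rightarrow> (('x \<Rightarrow> complex) \<Rightarrow> real) \<Rightarrow> ('x \<Rightarrow> complex) normed_structure" where
  "pointwise_space V N =
     \<lparr>vcarrier = V, vadd = (\<lambda>F G x. F x + G x), vzero = (\<lambda>x. 0),
      vscale = (\<lambda>a F x. a * F x), vnorm = N\<rparr>"


section \<open>Variable Lebesgue spaces on the real line\<close>

definition exponent_functions :: "(real \<Rightarrow> ennreal) set" where
  "exponent_functions = {p \<in> borel_measurable lebesgue. \<forall>x. 1 \<le> p x}"

definition log_Hoelder_at_infinity :: "(real \<Rightarrow> real) \<Rightarrow> real \<Rightarrow> bool" where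
  "log_Hoelder_at_infinity q l \<longleftrightarrow>
     (\<exists>C>0. AE x in lebesgue. \<bar>q x - l\<bar> \<le> C / ln (exp 1 + \<bar>x\<bar>))"

definition Lp_modular :: "(real \<Rightarrow> ennreal) \<Rightarrow> (real \<Rightarrow> complex) \<Rightarrow> ennreal" where
  "Lp_modular p f =
     (\<integral>\<^sup>+x\<in>{x. p x \<noteq> \<infinity>}. ennreal (cmod (f x) powr enn2real (p x)) \<partial>lebesgue)
     + esssup (restrict_space lebesgue {x. p x = \<infinity>}) (\<lambda>x. ennreal (cmod (f x)))"

definition Lp_functions :: "(real \<Rightarrow> ennreal) \<Rightarrow> (real \<Rightarrow> complex) set" where
  "Lp_functions p =
     {f \<in> borel_measurable lebesgue. \<exists>c>0. Lp_modular p (\<lambda>x. f x / complex_of_real c) < \<infinity>}"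

definition Lp_norm :: "(real \<Rightarrow> ennreal) \<Rightarrow> (real \<Rightarrow> complex) \<Rightarrow> real" where
  "Lp_norm p f = Inf {c. c > 0 \<and> Lp_modular p (\<lambda>x. f x / complex_of_real c) \<le> 1}"

definition Lp_rel :: "(real \<Rightarrow> ennreal) \<Rightarrow> ((real \<Rightarrow> complex) \<times> (real \<Rightarrow> complex)) set" where
  "Lp_rel p = {(f, g). f \<in> Lp_functions p \<and> g \<in> Lp_functions p \<and> (AE x in lebesgue. f x = g x)}"

text \<open>Elements of the normed space are classes of functions modulo equality almost
  everywhere; the operations and the norm are induced from representatives.\<close>

definition Lp_space :: "(real \<Rightarrow> ennreal) \<Rightarrow> (real \<Rightarrow> complex) set normed_structure" where
  "Lp_space p =
     \<lparr>vcarrier = Lp_functions p // Lp_rel p,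
      vadd = (\<lambda>A B. \<Union>f\<in>A. \<Union>g\<in>B. Lp_rel p `` {\<lambda>x. f x + g x}),
      vzero = Lp_rel p `` {\<lambda>x. 0},
      vscale = (\<lambda>a A. \<Union>f\<in>A. Lp_rel p `` {\<lambda>x. a * f x}),
      vnorm = (\<lambda>A. the_elem (Lp_norm p ` A))\<rparr>"


section \<open>Schwartz functions and distributions\<close>

definition nth_deriv :: "nat \<Rightarrow> (real \<Rightarrow> complex) \<Rightarrow> real \<Rightarrow> complex" where
  "nth_deriv k \<phi> = ((\<lambda>g x. vector_derivative g (at x)) ^^ k) \<phi>"

definition schwartz_functions :: "(real \<Rightarrow> complex) set" where
  "schwartz_functions =
     {\<phi>. (\<forall>k x. nth_deriv k \<phi> differentiable (at x)) \<and>
         (\<forall>j k. bdd_above (range (\<lambda>x. \<bar>x\<bar> ^ j * cmod (nth_deriv k \<phi> x))))}"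

definition schwartz_seminorm :: "nat \<Rightarrow> nat \<Rightarrow> (real \<Rightarrow> complex) \<Rightarrow> real" where
  "schwartz_seminorm j k \<phi> = (SUP x. \<bar>x\<bar> ^ j * cmod (nth_deriv k \<phi> x))"

text \<open>A functional on Schwartz functions is represented by a function on all of
  \<open>real \<Rightarrow> complex\<close> that vanishes off the Schwartz functions, so that equality of
  functionals is equality in the logic.\<close>

definition tempered_distributions :: "((real \<Rightarrow> complex) \<Rightarrow> complex) set" where
  "tempered_distributions =
     {T. (\<forall>\<phi>. \<phi> \<notin> schwartz_functions \<longrightarrow> T \<phi> = 0) \<and>
         (\<forall>\<phi>\<in>schwartz_functions. \<forall>\<psi>\<in>schwartz_functions. T (\<lambda>x. \<phi> x + \<psi> x) = T \<phi> + T \<psi>) \<and>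
         (\<forall>a. \<forall>\<phi>\<in>schwartz_functions. T (\<lambda>x. a * \<phi> x) = a * T \<phi>) \<and>
         (\<exists>C N. \<forall>\<phi>\<in>schwartz_functions.
            cmod (T \<phi>) \<le> C * (\<Sum>j\<le>N. \<Sum>k\<le>N. schwartz_seminorm j k \<phi>))}"

definition distributional_derivative ::
  "(real \<Rightarrow> complex) \<Rightarrow> (real \<Rightarrow> complex) \<Rightarrow> complex" where
  "distributional_derivative F =
     (\<lambda>\<phi>. if \<phi> \<in> schwartz_functions
          then - (LINT s|lebesgue. F s * vector_derivative \<phi> (at s)) else 0)"


section \<open>The integrated Fourier transform and its spaces\<close>

definition Psi_integrand :: "(real \<Rightarrow> complex) \<Rightarrow> real \<Rightarrow> real \<Rightarrow> complex" where
  "Psi_integrand f s t =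
     (1 - exp (- (\<i> * of_real s * of_real t))) / (\<i> * of_real t) * f t"

definition Psi :: "(real \<Rightarrow> complex) \<Rightarrow> real \<Rightarrow> complex" where
  "Psi f s = (if s = 0 then 0 else LINT t|lebesgue. Psi_integrand f s t)"

text \<open>The norms on the image spaces are given through representations by elements of the
  variable Lebesgue space; that the value does not depend on the representation has
  to be proved.\<close>

definition B_norm :: "(real \<Rightarrow> ennreal) \<Rightarrow> (real \<Rightarrow> complex) \<Rightarrow> real" where
  "B_norm p F = (THE r. \<exists>f\<in>Lp_functions p. F = Psi f \<and> r = Lp_norm p f)"

definition B_space :: "(real \<Rightarrow> ennreal) \<Rightarrow> (real \<Rightarrow> complex) normed_structure" where
  "B_space p = pointwise_space (Psi ` Lp_functions p) (B_norm p)"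

definition A_norm :: "(real \<Rightarrow> ennreal) \<Rightarrow> ((real \<Rightarrow> complex) \<Rightarrow> complex) \<Rightarrow> real" where
  "A_norm p T =
     (THE r. \<exists>f\<in>Lp_functions p. T = distributional_derivative (Psi f) \<and> r = Lp_norm p f)"

definition A_space :: "(real \<Rightarrow> ennreal) \<Rightarrow> ((real \<Rightarrow> complex) \<Rightarrow> complex) normed_structure" where
  "A_space p =
     pointwise_space ((\<lambda>f. distributional_derivative (Psi f)) ` Lp_functions p) (A_norm p)"

end

theory Submission
  imports Defs "HOL-Probability.Probability"
begin

text \<open>Everything rests on one embedding: under either hypothesis on the exponent there is a
  constant \<open>K\<close> with \<open>\<integral> |f(t)| / (1 + |t|) dt \<le> K * \<parallel>f\<parallel>\<close> (\<open>Lp_weighted_L1\<close>). If the exponent is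
  bounded by \<open>q\<close>, values of modulus at least 1 are controlled by the modular, and the others
  lie in the classical \<open>L\<^sup>q\<close>, on which the weight acts because it belongs to the dual space. If
  \<open>1/p\<close> tends to 1 logarithmically, the conjugate exponent grows at least like \<open>log |x|\<close>, so
  \<open>\<lambda> powr p'(x)\<close> is integrable for small \<open>\<lambda>\<close> and the functions are even integrable without
  weight.

  Three facts follow from the embedding.

  \<^item> The kernel \<open>(1 - exp(-ist)) / (it)\<close> is at most \<open>2 (1 + |s|) / (1 + |t|)\<close>, so \<open>Psi f\<close> is given
    by an absolutely convergent integral, grows at most linearly, and its product with the
    derivative of a Schwartz function is integrable.

  \<^item> The variable Lebesgue space is complete. A Cauchy sequence in the Luxemburg norm is Cauchy
    in the weighted \<open>L\<^sup>1\<close> space, hence has a subsequence converging almost everywhere, and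
    Fatou's lemma for the modular turns this into convergence in norm (\<open>Lp_complete\<close>).

  \<^item> The map from \<open>f\<close> to the distributional derivative of \<open>Psi f\<close> is injective modulo null
    functions. Fubini's theorem and an integration by parts show that this derivative is the
    distributional Fourier transform of \<open>f\<close>, that is \<open>\<phi>\<close> is sent to the integral of \<open>f\<close> against the
    Fourier transform of \<open>\<phi>\<close> (\<open>distributional_derivative_Psi_fourier\<close>). For translated Gaussians
    \<open>\<phi>\<close> this integral is, up to a constant, the Fourier transform of the integrable function
    \<open>f(t) exp(-t\<^sup>2/2)\<close>, and an integrable function whose Fourier transform vanishes is null by
    Levy's uniqueness theorem.

  If \<open>Psi f\<close> vanishes, so does its derivative; thus \<open>Psi\<close> is injective as well. A linear map with
  values in pointwise functions whose kernel consists of the null functions carries norm and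
  completeness of the variable Lebesgue space over to its range. This transport is carried out
  once, in the locale \<open>faithful_representation\<close>, and applies to both spaces of the theorem.\<close>

section \<open>Inequalities for real powers\<close>

text \<open>Convexity of \<open>x powr q\<close> on the open half line extends to the closed one, where moduli of
  function values live, because \<open>0 powr q = 0\<close> and \<open>r powr q \<le> r\<close> for \<open>r\<close> in the unit interval.\<close>

lemma powr_convex_nonneg:
  fixes a b s t q :: real
  assumes q: "1 \<le> q" and ab: "0 \<le> a" "0 \<le> b" and st: "0 \<le> s" "0 \<le> t" "s + t = 1"
  shows "(s * a + t * b) powr q \<le> s * a powr q + t * b powr q"
proof -
  have shrink: "(r * c) powr q \<le> r * c powr q" if "0 \<le> r" "r \<le> 1" "0 \<le> c" for r c :: real
  proof -
    have "r powr q \<le> r"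
      using powr_mono'[of 1 q r] q that by (cases "r = 0") auto
    then show ?thesis
      using that by (simp add: powr_mult mult_right_mono)
  qed
  show ?thesis
  proof (cases "a = 0 \<or> b = 0")
    case True
    then show ?thesis using shrink[of s a] shrink[of t b] ab st by auto
  next
    case False
    then have "a \<in> {0<..}" "b \<in> {0<..}" using ab by auto
    moreover have s: "s = 1 - t" "t \<le> 1" using st by auto
    ultimately show ?thesis
      unfolding s using convex_onD[OF powr_convex[OF q], of t a b] st by simp
  qed
qed

lemma integrable_inverse_weight_powr:
  fixes r :: real
  assumes r: "1 < r"
  shows "integrable lborel (\<lambda>x::real. (1 + \<bar>x\<bar>) powr (- r))"
proof (rule integrableI_nonneg)
  let ?h = "\<lambda>x::real. (1 + \<bar>x\<bar>) powr (- r)"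
  let ?F = "\<lambda>x::real. - ((1 + x) powr (1 - r)) / (r - 1)"
  have "(\<integral>\<^sup>+x. ennreal (?h x) * indicator {0..} x \<partial>lborel)
      = (\<integral>\<^sup>+x. ennreal ((1 + x) powr (- r)) * indicator {0..} x \<partial>lborel)"
    by (intro nn_integral_cong) (auto simp: indicator_def)
  also have "\<dots> = ennreal (0 - ?F 0)"
  proof (rule nn_integral_FTC_atLeast)
    show "DERIV ?F x :> (1 + x) powr (- r)" if "0 \<le> x" for x
    proof -
      have "DERIV (\<lambda>x. (1 + x) powr (1 - r)) x :> (1 - r) * (1 + x) powr (1 - r - of_nat 1) * 1"
        using that by (intro DERIV_fun_powr) (auto intro!: derivative_eq_intros)
      moreover have "- ((1 - r) * (1 + x) powr (1 - r - of_nat 1) * 1) / (r - 1) = (1 + x) powr (- r)"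
        using r by (simp add: field_simps)
      ultimately show ?thesis
        using DERIV_cdivide[OF DERIV_minus, of _ _ x UNIV "r - 1"] by metis
    qed
    have "((\<lambda>x::real. (1 + x) powr (1 - r)) \<longlongrightarrow> 0) at_top"
      using r by (intro tendsto_neg_powr filterlim_tendsto_add_at_top[OF tendsto_const])
        (auto intro: filterlim_ident)
    then have "((\<lambda>x. - ((1 + x) powr (1 - r)) / (r - 1)) \<longlongrightarrow> - 0 / (r - 1)) at_top"
      using r by (intro tendsto_intros) auto
    then show "(?F \<longlongrightarrow> 0) at_top" by simp
  qed auto
  finally have half: "(\<integral>\<^sup>+x. ennreal (?h x) * indicator {0..} x \<partial>lborel) < \<infinity>"
    by simp
  have "(\<integral>\<^sup>+x. ennreal (?h x) * indicator {..0} x \<partial>lborel)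
      = (\<integral>\<^sup>+x. ennreal (?h (- x)) * indicator {..0} (- x) \<partial>lborel)"
    by (subst lborel_distr_uminus[symmetric], subst nn_integral_distr) auto
  also have "\<dots> = (\<integral>\<^sup>+x. ennreal (?h x) * indicator {0..} x \<partial>lborel)"
    by (intro nn_integral_cong) (auto simp: indicator_def)
  finally have half': "(\<integral>\<^sup>+x. ennreal (?h x) * indicator {..0} x \<partial>lborel) < \<infinity>"
    using half by simp
  have "(\<integral>\<^sup>+x. ennreal (?h x) \<partial>lborel)
      \<le> (\<integral>\<^sup>+x. ennreal (?h x) * indicator {0..} x + ennreal (?h x) * indicator {..0} x \<partial>lborel)"
    by (intro nn_integral_mono) (auto simp: indicator_def)
  also have "\<dots> < \<infinity>"
    using half half' by (subst nn_integral_add) auto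
  finally show "(\<integral>\<^sup>+x. ennreal (?h x) \<partial>lborel) < \<infinity>" .
qed auto

text \<open>An elementary form of Young's inequality \<open>w u \<le> u\<^sup>q + w powr q'\<close> with
  \<open>q' = 1 + 1/(q - 1)\<close> that remains uniform in exponents \<open>P \<le> q\<close>: for \<open>u < 1\<close> the power with the
  smaller exponent is the larger one, and for \<open>u \<ge> 1\<close> the first summand alone suffices. Later
  \<open>w = 1/(1 + |t|)\<close>, and \<open>q' > 1\<close> makes the second summand integrable.\<close>

lemma powr_split_bounded_exponent:
  fixes u w P q :: real
  assumes u: "0 \<le> u" and w: "0 < w" "w \<le> 1" and P: "1 \<le> P" "P \<le> q" and q: "1 < q"
  shows "w * u \<le> u powr P + w powr (1 + 1 / (q - 1))"
proof -
  consider "u = 0" | "1 \<le> u" | "0 < u" "u < 1" "w \<le> u powr (q - 1)"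
    | "0 < u" "u < 1" "u powr (q - 1) < w" using u by linarith
  then show ?thesis
  proof cases
    case 2
    have "w * u \<le> u" using w u by (simp add: mult_left_le_one_le)
    also have "u \<le> u powr P" using powr_mono[of 1 P u] P 2 by auto
    finally show ?thesis by (simp add: add_increasing2)
  next
    case 3
    have "w * u \<le> u powr (q - 1) * u" using 3 u by (simp add: mult_right_mono)
    also have "\<dots> = u powr q" using 3 by (simp add: powr_mult_base mult.commute)
    also have "\<dots> \<le> u powr P" using 3 P powr_mono'[of P q u] by auto
    finally show ?thesis by (simp add: add_increasing2)
  next
    case 4
    have "u = (u powr (q - 1)) powr (1 / (q - 1))" using 4 q by (simp add: powr_powr)
    also have "\<dots> \<le> w powr (1 / (q - 1))" using 4 q by (intro powr_mono2) auto
    finally have "w * u \<le> w * w powr (1 / (q - 1))" using w by (simp add: mult_left_mono)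
    also have "\<dots> = w powr (1 + 1 / (q - 1))" using w by (simp add: powr_add)
    finally show ?thesis by (simp add: add_increasing)
  qed simp
qed

text \<open>Young's inequality with the free parameter \<open>\<lambda> = exp(-2C)\<close>. The hypothesis says that the
  conjugate exponent \<open>P'\<close> is at least \<open>ln y / C\<close>, whence \<open>\<lambda> powr P' \<le> y powr (-2)\<close>; the parameter
  is chosen to give precisely the exponent -2, which is integrable for \<open>y = e + |x|\<close>.\<close>

lemma powr_split_near_one:
  fixes u P C y :: real
  assumes u: "0 \<le> u" and P: "1 \<le> P" and C: "0 < C" and y: "1 < y"
    and conj_exponent: "1 - 1 / P \<le> C / ln y"
  shows "u \<le> exp (2 * C) * (u powr P + y powr (-2))"
proof -
  consider "u = 0" | "0 < u" "exp (-(2 * C)) \<le> u powr (P - 1)"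
    | "0 < u" "u powr (P - 1) < exp (-(2 * C))" using u by linarith
  then show ?thesis
  proof cases
    case 2
    have "u * exp (-(2*C)) \<le> u * u powr (P - 1)" using 2 by simp
    also have "\<dots> = u powr P" using 2 by (simp add: powr_mult_base)
    finally have "u \<le> exp (2 * C) * u powr P" by (simp add: exp_minus field_simps)
    also have "\<dots> \<le> exp (2 * C) * (u powr P + y powr (-2))" by simp
    finally show ?thesis .
  next
    case 3
    have "(P - 1) * ln u < - (2 * C)"
      using 3 by (simp add: powr_def split: if_splits)
    moreover from this have P1: "1 < P" using C P by (cases "P = 1") auto
    ultimately have 1: "ln u < - (2 * C) / (P - 1)" 
      by (subst pos_less_divide_eq) (auto simp: mult.commute)
    have "(P - 1) * ln y \<le> C * P" using conj_exponent y P1 by (simp add: field_simps)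
    then have "ln y \<le> C * P / (P - 1)" using P1 by (simp add: field_simps)
    moreover have "2 * C - 2 * (C * P / (P - 1)) = - (2 * C) / (P - 1)" using P1 by (simp add: field_simps)
    ultimately have "ln u \<le> 2 * C - 2 * ln y" using 1 by linarith
    then have "exp (ln u) \<le> exp (2 * C + (-2) * ln y)" by (subst exp_le_cancel_iff) linarith
    then have "u \<le> exp (2 * C) * y powr (-2)" using 3 y by (simp add: exp_diff exp_minus powr_def field_simps)
    also have "\<dots> \<le> exp (2 * C) * (u powr P + y powr (-2))" by simp
    finally show ?thesis .
  qed simp
qed

section \<open>The modular\<close>

locale variable_exponent =
  fixes p :: "real \<Rightarrow> ennreal"
  assumes exponent: "p \<in> exponent_functions"
begin

lemma exponent_measurable [measurable]: "p \<in> borel_measurable lebesgue"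
  using exponent by (simp add: exponent_functions_def)

lemma exponent_ge_1: "1 \<le> p x"
  using exponent by (simp add: exponent_functions_def)

lemma enn2real_exponent_ge_1: "p x \<noteq> \<infinity> \<Longrightarrow> 1 \<le> enn2real (p x)"
  using exponent_ge_1[of x] enn2real_mono[of 1 "p x"] by (auto simp: less_top)

lemma sets_exponent_infinite: "{x. p x = \<infinity>} \<in> sets lebesgue"
proof -
  have "{x \<in> space lebesgue. p x = \<infinity>} \<in> sets lebesgue" by measurable
  then show ?thesis by simp
qed

text \<open>The modular is treated as a sum of an integral over the set where the exponent is finite
  and an essential supremum over its complement, since convexity and lower semicontinuity are
  proved for the two summands by different means.\<close>

definition finite_part :: "(real \<Rightarrow> complex) \<Rightarrow> ennreal" where
  "finite_part f =
     (\<integral>\<^sup>+x\<in>{x. p x \<noteq> \<infinity>}. ennreal (cmod (f x) powr enn2real (p x)) \<partial>lebesgue)"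

definition infinite_part :: "(real \<Rightarrow> complex) \<Rightarrow> ennreal" where
  "infinite_part f = esssup (restrict_space lebesgue {x. p x = \<infinity>}) (\<lambda>x. ennreal (cmod (f x)))"

lemma Lp_modular_split: "Lp_modular p f = finite_part f + infinite_part f"
  by (simp add: Lp_modular_def finite_part_def infinite_part_def)

lemma finite_part_measurable [measurable]:
  assumes [measurable]: "f \<in> borel_measurable lebesgue"
  shows "(\<lambda>x. ennreal (cmod (f x) powr enn2real (p x)) * indicator {x. p x \<noteq> \<infinity>} x)
    \<in> borel_measurable lebesgue"
proof -
  have "{x. p x \<noteq> \<infinity>} = space lebesgue - {x. p x = \<infinity>}" by auto
  then have [measurable]: "{x. p x \<noteq> \<infinity>} \<in> sets lebesgue"
    using sets_exponent_infinite by (metis sets.compl_sets)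
  show ?thesis by measurable
qed

lemma AE_infinite_iff:
  "(AE x in restrict_space lebesgue {x. p x = \<infinity>}. P x)
    \<longleftrightarrow> (AE x in lebesgue. p x = \<infinity> \<longrightarrow> P x)"
  using sets_exponent_infinite by (subst AE_restrict_space_iff) auto

text \<open>Reduces statements on the essential supremum over the set where the exponent is infinite
  to statements that hold almost everywhere on the line.\<close>

lemma infinite_part_le_iff:
  assumes [measurable]: "f \<in> borel_measurable lebesgue"
  shows "infinite_part f \<le> c \<longleftrightarrow> (AE x in lebesgue. p x = \<infinity> \<longrightarrow> ennreal (cmod (f x)) \<le> c)"
proof -
  let ?M = "restrict_space lebesgue {x. p x = \<infinity>}"
  have m: "(\<lambda>x. ennreal (cmod (f x))) \<in> borel_measurable ?M"
    by (rule measurable_restrict_space1) measurable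
  have "infinite_part f \<le> c \<longleftrightarrow> (AE x in ?M. ennreal (cmod (f x)) \<le> c)"
    unfolding infinite_part_def
    using esssup_I[OF m] esssup_AE[of "\<lambda>x. ennreal (cmod (f x))" ?M]
    by (auto elim!: eventually_mono intro: order_trans)
  then show ?thesis by (simp add: AE_infinite_iff)
qed

lemma AE_le_infinite_part:
  "f \<in> borel_measurable lebesgue \<Longrightarrow>
    AE x in lebesgue. p x = \<infinity> \<longrightarrow> ennreal (cmod (f x)) \<le> infinite_part f"
  using infinite_part_le_iff[of f "infinite_part f"] by simp

lemma Lp_modular_mono_AE:
  assumes f [measurable]: "f \<in> borel_measurable lebesgue" "g \<in> borel_measurable lebesgue"
    and le: "AE x in lebesgue. cmod (f x) \<le> cmod (g x)"
  shows "Lp_modular p f \<le> Lp_modular p g"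
  unfolding Lp_modular_split
proof (rule add_mono)
  show "finite_part f \<le> finite_part g"
    unfolding finite_part_def
  proof (rule nn_integral_mono_AE, use le in eventually_elim)
    fix x assume "cmod (f x) \<le> cmod (g x)"
    then show "ennreal (cmod (f x) powr enn2real (p x)) * indicator {x. p x \<noteq> \<infinity>} x
        \<le> ennreal (cmod (g x) powr enn2real (p x)) * indicator {x. p x \<noteq> \<infinity>} x"
      by (auto simp: indicator_def intro!: powr_mono2)
  qed
  show "infinite_part f \<le> infinite_part g"
    unfolding infinite_part_le_iff[OF f(1)]
    using le AE_le_infinite_part[OF f(2)]
    by eventually_elim (auto intro: order_trans ennreal_leI)
qed

lemma Lp_modular_zero: "Lp_modular p (\<lambda>x. 0) = 0"
proof -
  have "infinite_part (\<lambda>x. 0) \<le> 0" by (subst infinite_part_le_iff) auto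
  then show ?thesis by (simp add: Lp_modular_split finite_part_def)
qed

lemma Lp_modular_convex:
  assumes f [measurable]: "f \<in> borel_measurable lebesgue" "g \<in> borel_measurable lebesgue"
    and st: "0 \<le> s" "0 \<le> t" "s + t = 1"
  shows "Lp_modular p (\<lambda>x. of_real s * f x + of_real t * g x)
    \<le> ennreal s * Lp_modular p f + ennreal t * Lp_modular p g"
proof -
  let ?h = "\<lambda>x. of_real s * f x + of_real t * g x"
  have tri: "cmod (?h x) \<le> s * cmod (f x) + t * cmod (g x)" for x
    using norm_triangle_ineq[of "of_real s * f x" "of_real t * g x"] st by (simp add: norm_mult)
  have "finite_part ?h \<le> (\<integral>\<^sup>+x. ennreal s * (ennreal (cmod (f x) powr enn2real (p x)) * indicator {x. p x \<noteq> \<infinity>} x)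
      + ennreal t * (ennreal (cmod (g x) powr enn2real (p x)) * indicator {x. p x \<noteq> \<infinity>} x) \<partial>lebesgue)"
    unfolding finite_part_def
  proof (rule nn_integral_mono)
    fix x
    show "ennreal (cmod (?h x) powr enn2real (p x)) * indicator {x. p x \<noteq> \<infinity>} x
      \<le> ennreal s * (ennreal (cmod (f x) powr enn2real (p x)) * indicator {x. p x \<noteq> \<infinity>} x)
      + ennreal t * (ennreal (cmod (g x) powr enn2real (p x)) * indicator {x. p x \<noteq> \<infinity>} x)"
    proof (cases "p x = \<infinity>")
      case False
      note P = enn2real_exponent_ge_1[OF this]
      have "cmod (?h x) powr enn2real (p x) \<le> (s * cmod (f x) + t * cmod (g x)) powr enn2real (p x)"
        using tri P by (intro powr_mono2) auto
      also have "\<dots> \<le> s * cmod (f x) powr enn2real (p x) + t * cmod (g x) powr enn2real (p x)"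
        using P st by (intro powr_convex_nonneg) auto
      finally show ?thesis
        using False st by (simp add: ennreal_mult'[symmetric] ennreal_plus[symmetric] del: ennreal_plus)
    qed simp
  qed
  also have "\<dots> = ennreal s * finite_part f + ennreal t * finite_part g"
    unfolding finite_part_def by (subst nn_integral_add) (auto simp: nn_integral_cmult)
  finally have 1: "finite_part ?h \<le> ennreal s * finite_part f + ennreal t * finite_part g" .
  have 2: "infinite_part ?h \<le> ennreal s * infinite_part f + ennreal t * infinite_part g"
  proof (subst infinite_part_le_iff)
    show "AE x in lebesgue. p x = \<infinity> \<longrightarrow>
        ennreal (cmod (?h x)) \<le> ennreal s * infinite_part f + ennreal t * infinite_part g"
      using AE_le_infinite_part[OF f(1)] AE_le_infinite_part[OF f(2)]
    proof eventually_elim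
      case (elim x)
      have "ennreal (cmod (?h x)) \<le> ennreal (s * cmod (f x) + t * cmod (g x))"
        using tri by (rule ennreal_leI)
      also have "\<dots> = ennreal s * ennreal (cmod (f x)) + ennreal t * ennreal (cmod (g x))"
        using st by (simp add: ennreal_mult')
      finally show ?case
        using elim by (auto elim!: order_trans intro!: add_mono mult_left_mono)
    qed
  qed measurable
  show ?thesis
    using add_mono[OF 1 2] by (simp add: Lp_modular_split distrib_left ac_simps)
qed

lemma Lp_modular_scale_le:
  assumes "f \<in> borel_measurable lebesgue" "0 \<le> s" "s \<le> 1"
  shows "Lp_modular p (\<lambda>x. of_real s * f x) \<le> ennreal s * Lp_modular p f"
  using Lp_modular_convex[of f "\<lambda>x. 0" s "1 - s"] assms by (simp add: Lp_modular_zero)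

text \<open>A form of Fatou's lemma for the modular. Both parts of the modular of the limit are at most 1
  separately; halving the limit absorbs the factor 2 of their sum. The loss of this factor is harmless
  for convergence in norm.\<close>

lemma Lp_modular_half_limit:
  assumes h [measurable]: "\<And>m. h m \<in> borel_measurable lebesgue" "g \<in> borel_measurable lebesgue"
    and le: "\<And>m. Lp_modular p (h m) \<le> 1"
    and lim: "AE x in lebesgue. (\<lambda>m. h m x) \<longlonglongrightarrow> g x"
  shows "Lp_modular p (\<lambda>x. of_real (1/2) * g x) \<le> 1"
proof -
  have fin: "finite_part (h m) \<le> 1" and inf: "infinite_part (h m) \<le> 1" for m
    using le[of m] unfolding Lp_modular_split
    by (auto intro: order_trans[OF _ le[of m, unfolded Lp_modular_split]])
  let ?I = "\<lambda>f x. ennreal (cmod (f x) powr enn2real (p x)) * indicator {x. p x \<noteq> \<infinity>} x"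
  have "finite_part g = (\<integral>\<^sup>+x. liminf (\<lambda>m. ?I (h m) x) \<partial>lebesgue)"
    unfolding finite_part_def
  proof (rule nn_integral_cong_AE, use lim in eventually_elim)
    fix x assume x: "(\<lambda>m. h m x) \<longlonglongrightarrow> g x"
    have "(\<lambda>m. ?I (h m) x) \<longlonglongrightarrow> ?I g x"
    proof (cases "p x = \<infinity>")
      case False
      then have "(\<lambda>m. cmod (h m x) powr enn2real (p x)) \<longlonglongrightarrow> cmod (g x) powr enn2real (p x)"
        using enn2real_exponent_ge_1[OF False] x
        by (intro tendsto_powr' tendsto_norm tendsto_const) (auto intro!: always_eventually)
      then show ?thesis using False by simp
    qed simp
    then show "?I g x = liminf (\<lambda>m. ?I (h m) x)"
      by (simp add: lim_imp_Liminf)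
  qed
  also have "\<dots> \<le> liminf (\<lambda>m. finite_part (h m))"
    unfolding finite_part_def by (rule nn_integral_liminf) measurable
  also have "\<dots> \<le> 1" using fin by (auto intro!: Liminf_le always_eventually)
  finally have 1: "finite_part g \<le> 1" .
  have "AE x in lebesgue. \<forall>m. p x = \<infinity> \<longrightarrow> ennreal (cmod (h m x)) \<le> 1"
    unfolding AE_all_countable using inf by (simp add: infinite_part_le_iff)
  then have 2: "infinite_part g \<le> 1"
    unfolding infinite_part_le_iff[OF h(2)] using lim
  proof eventually_elim
    case (elim x)
    have "cmod (g x) \<le> 1" if "p x = \<infinity>"
      using elim that by (intro tendsto_upperbound[OF tendsto_norm[OF elim(2)]])
        (auto intro!: always_eventually)
    then show ?case by simp
  qed
  have "Lp_modular p (\<lambda>x. of_real (1/2) * g x) \<le> ennreal (1/2) * Lp_modular p g"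
    by (rule Lp_modular_scale_le) auto
  also have "\<dots> \<le> ennreal (1/2) * (1 + 1)"
    unfolding Lp_modular_split using 1 2 by (intro mult_left_mono add_mono) auto
  also have "\<dots> = ennreal (1/2) * ennreal 2" by simp
  also have "\<dots> = 1" by (subst ennreal_mult'[symmetric]) auto
  finally show ?thesis .
qed

end

section \<open>The Luxemburg norm\<close>

lemma ident_measurable_lebesgue: "(\<lambda>x::real. x) \<in> borel_measurable lebesgue"
  by (rule measurable_completion) simp

context variable_exponent
begin

lemma Lp_functions_measurable: "f \<in> Lp_functions p \<Longrightarrow> f \<in> borel_measurable lebesgue"
  by (simp add: Lp_functions_def)

lemma Lp_functionsI:
  "\<lbrakk>f \<in> borel_measurable lebesgue; 0 < c; Lp_modular p (\<lambda>x. f x / of_real c) \<le> 1\<rbrakk>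
    \<Longrightarrow> f \<in> Lp_functions p"
  unfolding Lp_functions_def by (auto intro!: exI[of _ c] intro: le_less_trans)

lemma Lp_functions_modular_le_1:
  assumes f: "f \<in> Lp_functions p"
  obtains c where "0 < c" "Lp_modular p (\<lambda>x. f x / of_real c) \<le> 1"
proof -
  note [measurable] = Lp_functions_measurable[OF f]
  obtain c where c: "c > 0" "Lp_modular p (\<lambda>x. f x / of_real c) < \<infinity>"
    using f by (auto simp: Lp_functions_def)
  define r where "r = enn2real (Lp_modular p (\<lambda>x. f x / of_real c))"
  have r: "0 \<le> r" "Lp_modular p (\<lambda>x. f x / of_real c) = ennreal r"
    using c by (auto simp: r_def)
  let ?s = "1 / (1 + r)"
  have eq: "(\<lambda>x. f x / of_real (c * (1 + r))) = (\<lambda>x. of_real ?s * (f x / of_real c))"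
    by (auto simp: field_simps)
  have "Lp_modular p (\<lambda>x. f x / of_real (c * (1 + r))) \<le> ennreal ?s * Lp_modular p (\<lambda>x. f x / of_real c)"
    unfolding eq using r by (intro Lp_modular_scale_le) auto
  also have "\<dots> \<le> 1"
    using r by (simp add: ennreal_mult'[symmetric])
  finally show ?thesis
    using that[of "c * (1 + r)"] c r by simp
qed

lemma Lp_norm_le:
  "0 < c \<Longrightarrow> Lp_modular p (\<lambda>x. f x / of_real c) \<le> 1 \<Longrightarrow> Lp_norm p f \<le> c"
  unfolding Lp_norm_def by (rule cInf_lower) (auto intro!: bdd_belowI[of _ 0])

lemma Lp_norm_nonneg:
  assumes "f \<in> Lp_functions p"
  shows "0 \<le> Lp_norm p f"
  using Lp_functions_modular_le_1[OF assms] unfolding Lp_norm_def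
  by (intro cInf_greatest) (auto intro: less_imp_le)

lemma Lp_modular_le_1:
  assumes f: "f \<in> Lp_functions p" and c: "Lp_norm p f < c"
  shows "Lp_modular p (\<lambda>x. f x / of_real c) \<le> 1"
proof -
  note [measurable] = Lp_functions_measurable[OF f]
  have "{c. c > 0 \<and> Lp_modular p (\<lambda>x. f x / complex_of_real c) \<le> 1} \<noteq> {}"
    using Lp_functions_modular_le_1[OF f] by blast
  from cInf_lessD[OF this, of c] obtain d where
    d: "0 < d" "d < c" "Lp_modular p (\<lambda>x. f x / of_real d) \<le> 1"
    using c by (auto simp: Lp_norm_def)
  have "Lp_modular p (\<lambda>x. f x / of_real c) \<le> Lp_modular p (\<lambda>x. f x / of_real d)"
    using d by (intro Lp_modular_mono_AE) (auto simp: norm_divide intro!: divide_left_mono)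
  with d show ?thesis by simp
qed

text \<open>The modular depends only on the modulus of the function, and increasingly so; this also gives
  the invariance of the norm under changes on null sets.\<close>

lemma Lp_norm_mono_AE:
  assumes f: "f \<in> borel_measurable lebesgue" and g: "g \<in> Lp_functions p"
    and le: "AE x in lebesgue. cmod (f x) \<le> cmod (g x)"
  shows "f \<in> Lp_functions p" "Lp_norm p f \<le> Lp_norm p g"
proof -
  note [measurable] = f Lp_functions_measurable[OF g]
  have *: "Lp_modular p (\<lambda>x. f x / of_real c) \<le> 1"
    if "0 < c" "Lp_modular p (\<lambda>x. g x / of_real c) \<le> 1" for c
  proof -
    have "Lp_modular p (\<lambda>x. f x / of_real c) \<le> Lp_modular p (\<lambda>x. g x / of_real c)"
      using le that by (intro Lp_modular_mono_AE)
        (auto simp: norm_divide divide_right_mono elim!: eventually_mono)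
    with that show ?thesis by simp
  qed
  show "f \<in> Lp_functions p"
  proof -
    obtain c where "0 < c" "Lp_modular p (\<lambda>x. g x / of_real c) \<le> 1"
      using Lp_functions_modular_le_1[OF g] .
    then show ?thesis by (intro Lp_functionsI[OF f _ *])
  qed
  show "Lp_norm p f \<le> Lp_norm p g"
  proof (rule dense_ge)
    fix c assume c: "Lp_norm p g < c"
    then have "0 < c" using Lp_norm_nonneg[OF g] by linarith
    with c show "Lp_norm p f \<le> c" by (intro Lp_norm_le * Lp_modular_le_1[OF g])
  qed
qed

lemma Lp_norm_cong_AE:
  assumes "f \<in> Lp_functions p" "g \<in> Lp_functions p" "AE x in lebesgue. f x = g x"
  shows "Lp_norm p f = Lp_norm p g"
  using assms by (intro antisym Lp_norm_mono_AE(2)) (auto simp: Lp_functions_measurable)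

lemma zero_in_Lp_functions: "(\<lambda>x. 0) \<in> Lp_functions p"
  by (rule Lp_functionsI[of _ 1]) (auto simp: Lp_modular_zero)

lemma Lp_norm_zero: "Lp_norm p (\<lambda>x. 0) = 0"
proof (rule antisym)
  show "Lp_norm p (\<lambda>x. 0) \<le> 0"
    by (rule dense_ge, rule Lp_norm_le) (auto simp: Lp_modular_zero)
qed (rule Lp_norm_nonneg[OF zero_in_Lp_functions])

text \<open>The triangle inequality for the Luxemburg norm is convexity of the modular:
  \<open>(f + g) / (a + b)\<close> is the convex combination of \<open>f / a\<close> and \<open>g / b\<close> with weights
  \<open>a / (a + b)\<close> and \<open>b / (a + b)\<close>.\<close>

lemma Lp_modular_add_le_1:
  assumes f [measurable]: "f \<in> borel_measurable lebesgue" "g \<in> borel_measurable lebesgue"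
    and ab: "0 < a" "0 < b" "Lp_modular p (\<lambda>x. f x / of_real a) \<le> 1" "Lp_modular p (\<lambda>x. g x / of_real b) \<le> 1"
  shows "Lp_modular p (\<lambda>x. (f x + g x) / of_real (a + b)) \<le> 1"
proof -
  let ?s = "a / (a + b)" and ?t = "b / (a + b)"
  have st: "0 \<le> ?s" "0 \<le> ?t" "?s + ?t = 1" using ab by (auto simp: add_divide_distrib[symmetric])
  have nz: "complex_of_real a + complex_of_real b \<noteq> 0" using ab by (simp flip: of_real_add)
  have eq: "(\<lambda>x. (f x + g x) / of_real (a + b))
      = (\<lambda>x. of_real ?s * (f x / of_real a) + of_real ?t * (g x / of_real b))"
    using ab nz by (auto simp: add_divide_distrib)
  have "Lp_modular p (\<lambda>x. (f x + g x) / of_real (a + b))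
      \<le> ennreal ?s * Lp_modular p (\<lambda>x. f x / of_real a) + ennreal ?t * Lp_modular p (\<lambda>x. g x / of_real b)"
    unfolding eq using st by (intro Lp_modular_convex) auto
  also have "\<dots> \<le> ennreal ?s * 1 + ennreal ?t * 1"
    using ab by (intro add_mono mult_left_mono) auto
  also have "\<dots> = 1" using st by (simp flip: ennreal_plus)
  finally show ?thesis .
qed

lemma Lp_functions_add:
  assumes f: "f \<in> Lp_functions p" and g: "g \<in> Lp_functions p"
  shows "(\<lambda>x. f x + g x) \<in> Lp_functions p"
proof -
  note [measurable] = Lp_functions_measurable[OF f] Lp_functions_measurable[OF g]
  obtain a b where ab: "0 < a" "0 < b"
    "Lp_modular p (\<lambda>x. f x / of_real a) \<le> 1" "Lp_modular p (\<lambda>x. g x / of_real b) \<le> 1"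
    using Lp_functions_modular_le_1[OF f] Lp_functions_modular_le_1[OF g] by metis
  then show ?thesis
    by (intro Lp_functionsI[OF _ _ Lp_modular_add_le_1]) auto
qed

lemma Lp_norm_triangle:
  assumes f: "f \<in> Lp_functions p" and g: "g \<in> Lp_functions p"
  shows "Lp_norm p (\<lambda>x. f x + g x) \<le> Lp_norm p f + Lp_norm p g"
proof (rule field_le_epsilon)
  fix e :: real assume e: "0 < e"
  note [measurable] = Lp_functions_measurable[OF f] Lp_functions_measurable[OF g]
  let ?a = "Lp_norm p f + e/2" and ?b = "Lp_norm p g + e/2"
  have "Lp_norm p (\<lambda>x. f x + g x) \<le> ?a + ?b"
    using e Lp_norm_nonneg[OF f] Lp_norm_nonneg[OF g]
    by (intro Lp_norm_le Lp_modular_add_le_1 Lp_modular_le_1[OF f] Lp_modular_le_1[OF g]) auto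
  then show "Lp_norm p (\<lambda>x. f x + g x) \<le> Lp_norm p f + Lp_norm p g + e" by simp
qed

lemma Lp_scale_nonzero:
  assumes f: "f \<in> Lp_functions p" and k: "a \<noteq> 0"
  shows "(\<lambda>x. a * f x) \<in> Lp_functions p" "Lp_norm p (\<lambda>x. a * f x) \<le> cmod a * Lp_norm p f"
proof -
  note [measurable] = Lp_functions_measurable[OF f]
  have *: "Lp_modular p (\<lambda>x. (a * f x) / of_real (cmod a * c)) \<le> 1"
    if "0 < c" "Lp_modular p (\<lambda>x. f x / of_real c) \<le> 1" for c
  proof -
    have "Lp_modular p (\<lambda>x. (a * f x) / of_real (cmod a * c)) \<le> Lp_modular p (\<lambda>x. f x / of_real c)"
      using k by (intro Lp_modular_mono_AE) (auto simp: norm_divide norm_mult)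
    with that show ?thesis by simp
  qed
  obtain c where "0 < c" "Lp_modular p (\<lambda>x. f x / of_real c) \<le> 1"
    using Lp_functions_modular_le_1[OF f] .
  then show "(\<lambda>x. a * f x) \<in> Lp_functions p"
    using k by (intro Lp_functionsI[OF _ _ *]) auto
  show "Lp_norm p (\<lambda>x. a * f x) \<le> cmod a * Lp_norm p f"
  proof (rule field_le_epsilon)
    fix e :: real assume e: "0 < e"
    let ?c = "Lp_norm p f + e / cmod a"
    have c: "0 < ?c" "Lp_norm p f < ?c" using e k Lp_norm_nonneg[OF f] by (auto intro: add_nonneg_pos)
    have "Lp_norm p (\<lambda>x. a * f x) \<le> cmod a * ?c"
      using k by (intro Lp_norm_le * Lp_modular_le_1[OF f] c mult_pos_pos) auto
    then show "Lp_norm p (\<lambda>x. a * f x) \<le> cmod a * Lp_norm p f + e"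
      using k by (simp add: distrib_left)
  qed
qed

lemma Lp_functions_scale: "f \<in> Lp_functions p \<Longrightarrow> (\<lambda>x. a * f x) \<in> Lp_functions p"
  using Lp_scale_nonzero(1)[of f a] zero_in_Lp_functions by (cases "a = 0") auto

lemma Lp_norm_scale:
  assumes f: "f \<in> Lp_functions p"
  shows "Lp_norm p (\<lambda>x. a * f x) = cmod a * Lp_norm p f"
proof (cases "a = 0")
  case False
  have "Lp_norm p (\<lambda>x. inverse a * (a * f x)) \<le> cmod (inverse a) * Lp_norm p (\<lambda>x. a * f x)"
    using False f by (intro Lp_scale_nonzero) auto
  then have "cmod a * Lp_norm p f \<le> Lp_norm p (\<lambda>x. a * f x)"
    using False by (simp add: norm_divide norm_inverse field_simps)
  with Lp_scale_nonzero(2)[OF f False] show ?thesis by simp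
qed (simp add: Lp_norm_zero)

lemma Lp_functions_diff:
  "\<lbrakk>f \<in> Lp_functions p; g \<in> Lp_functions p\<rbrakk> \<Longrightarrow> (\<lambda>x. f x - g x) \<in> Lp_functions p"
  using Lp_functions_add[OF _ Lp_functions_scale, of f g "-1"] by simp

end

section \<open>Embedding into a weighted L1 space\<close>

locale admissible_exponent = variable_exponent +
  assumes admissible:
    "esssup lebesgue p < \<infinity> \<or> log_Hoelder_at_infinity (\<lambda>x. enn2real (1 / p x)) 1"
begin

text \<open>The set where the exponent is infinite is null here. The bound on the exponent is raised to at
  least 2 in order that its conjugate exponent be finite.\<close>

lemma pointwise_weight_bound_bounded_exponent:
  assumes "esssup lebesgue p < \<infinity>"
  shows "\<exists>h. integrable lborel h \<and> (\<forall>f. f \<in> borel_measurable lebesgue \<longrightarrow> Lp_modular p f \<le> 1 \<longrightarrow>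
    (AE x in lebesgue. p x \<noteq> \<infinity> \<and> cmod (f x) / (1 + \<bar>x\<bar>) \<le> cmod (f x) powr enn2real (p x) + h x))"
proof -
  define q where "q = max 2 (enn2real (esssup lebesgue p))"
  have q: "1 < q" by (simp add: q_def)
  let ?h = "\<lambda>x::real. (1 + \<bar>x\<bar>) powr (- (1 + 1 / (q - 1)))"
  have "AE x in lebesgue. p x \<noteq> \<infinity> \<and> enn2real (p x) \<le> q"
    using esssup_AE[of p lebesgue]
  proof eventually_elim
    case (elim x)
    then have "p x < \<infinity>" using assms by (auto intro: le_less_trans)
    moreover have "enn2real (p x) \<le> enn2real (esssup lebesgue p)"
      using elim assms by (intro enn2real_mono) auto
    ultimately have "p x \<noteq> \<infinity>" "enn2real (p x) \<le> q" by (auto simp: q_def le_max_iff_disj simp del: enn2real_le)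
    then show ?case by blast
  qed
  then have "AE x in lebesgue. p x \<noteq> \<infinity> \<and> cmod (f x) / (1 + \<bar>x\<bar>) \<le> cmod (f x) powr enn2real (p x) + ?h x" for f :: "real \<Rightarrow> complex"
  proof eventually_elim
    case (elim x)
    let ?w = "1 / (1 + \<bar>x\<bar>)"
    have "?w * cmod (f x) \<le> cmod (f x) powr enn2real (p x) + ?w powr (1 + 1 / (q - 1))"
      using elim q enn2real_exponent_ge_1[of x] by (intro powr_split_bounded_exponent) auto
    moreover have "?w powr (1 + 1 / (q - 1)) = ?h x"
      
      using powr_minus_divide[of "1 + \<bar>x\<bar>" "1 + 1 / (q - 1)"] by (simp add: powr_divide)
    ultimately show ?case using elim by simp
  qed
  moreover have "integrable lborel ?h"
    using q by (intro integrable_inverse_weight_powr) auto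
  ultimately show ?thesis by blast
qed

text \<open>Where the exponent is infinite, the hypothesis reads \<open>1 \<le> C / ln (e + |x|)\<close>. It confines this
  set to a bounded interval up to a null set, and there \<open>exp(2C) (e + |x|) powr (-2) \<ge> 1\<close> dominates
  a function of modulus at most 1.\<close>

lemma pointwise_weight_bound_log_Hoelder:
  assumes "log_Hoelder_at_infinity (\<lambda>x. enn2real (1 / p x)) 1"
  shows "\<exists>C h. 0 \<le> C \<and> integrable lborel h \<and> (\<forall>f. f \<in> borel_measurable lebesgue \<longrightarrow> Lp_modular p f \<le> 1 \<longrightarrow>
    (AE x in lebesgue. cmod (f x) / (1 + \<bar>x\<bar>) \<le>
       C * (cmod (f x) powr enn2real (p x) * indicator {x. p x \<noteq> \<infinity>} x) + h x))"
proof -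
  obtain C where C: "C > 0"
    and AEC: "AE x in lebesgue. \<bar>enn2real (1 / p x) - 1\<bar> \<le> C / ln (exp 1 + \<bar>x\<bar>)"
    using assms by (auto simp: log_Hoelder_at_infinity_def)
  let ?h = "\<lambda>x::real. exp (2 * C) * (1 + \<bar>x\<bar>) powr (- 2)"
  have "AE x in lebesgue. cmod (f x) / (1 + \<bar>x\<bar>) \<le>
       exp (2 * C) * (cmod (f x) powr enn2real (p x) * indicator {x. p x \<noteq> \<infinity>} x) + ?h x"
    if f [measurable]: "f \<in> borel_measurable lebesgue" and le1: "Lp_modular p f \<le> 1" for f
  proof -
    have "infinite_part f \<le> 1"
      using le1 by (auto simp: Lp_modular_split intro: order_trans[rotated])
    then have "AE x in lebesgue. p x = \<infinity> \<longrightarrow> ennreal (cmod (f x)) \<le> 1"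
      by (simp add: infinite_part_le_iff)
    then show ?thesis using AEC
    proof eventually_elim
      case (elim x)
      let ?y = "exp 1 + \<bar>x\<bar>" and ?u = "cmod (f x)"
      have e: "(1::real) < exp 1" by simp
      have y: "1 + \<bar>x\<bar> \<le> ?y" "1 < ?y" using e by linarith+
      have y2: "?y powr (-2) \<le> (1 + \<bar>x\<bar>) powr (-2)"
        using y by (intro powr_mono2') auto
      have lny: "0 < ln ?y" using y by simp
      have "?u / (1 + \<bar>x\<bar>) \<le> ?u"
        by (simp add: field_simps mult_nonneg_nonneg)
      also have "?u \<le> exp (2 * C) * (?u powr enn2real (p x) * indicator {x. p x \<noteq> \<infinity>} x + ?y powr (-2))"
      proof (cases "p x = \<infinity>")
        case True
        then have "?u \<le> 1" "1 \<le> C / ln ?y" using elim by auto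
        then have "2 * ln ?y \<le> 2 * C" using lny by (simp add: field_simps)
        then have "1 \<le> exp (2 * C + (-2) * ln ?y)" by simp
        then have "1 \<le> exp (2 * C) * ?y powr (-2)"
          using y by (simp add: exp_diff exp_minus powr_def field_simps)
        with \<open>?u \<le> 1\<close> True show ?thesis by simp
      next
        case False
        note P = enn2real_exponent_ge_1[OF False]
        have px: "p x = ennreal (enn2real (p x))" using False by (simp add: less_top)
        have "enn2real (1 / p x) = 1 / enn2real (p x)"
          using P by (subst px, subst ennreal_1[symmetric], subst divide_ennreal) auto
        then have "1 - 1 / enn2real (p x) \<le> C / ln ?y" using elim P by auto
        then show ?thesis
          using False P C y by (simp add: powr_split_near_one)
      qed
      also have "\<dots> \<le> exp (2 * C) * (?u powr enn2real (p x) * indicator {x. p x \<noteq> \<infinity>} x + (1 + \<bar>x\<bar>) powr (-2))"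
        using y2 by (intro mult_left_mono add_left_mono) auto
      finally show ?case by (simp add: distrib_left)
    qed
  qed
  moreover have "integrable lborel ?h"
    using integrable_inverse_weight_powr[of 2] by (intro integrable_mult_right) auto
  ultimately show ?thesis
    by (intro exI[of _ "exp (2 * C)"] exI[of _ ?h]) auto
qed

text \<open>The two alternatives for the exponent yield pointwise bounds of the same shape; integrating them
  gives one constant for the unit ball of the modular.\<close>

lemma Lp_weighted_L1_modular:
  "\<exists>K\<ge>0. \<forall>f. f \<in> borel_measurable lebesgue \<longrightarrow> Lp_modular p f \<le> 1 \<longrightarrow>
     (\<integral>\<^sup>+x. ennreal (cmod (f x) / (1 + \<bar>x\<bar>)) \<partial>lebesgue) \<le> ennreal K"
proof -
  have "\<exists>C h. 0 \<le> C \<and> integrable lborel h \<and> (\<forall>f. f \<in> borel_measurable lebesgue \<longrightarrow> Lp_modular p f \<le> 1 \<longrightarrow>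
    (AE x in lebesgue. cmod (f x) / (1 + \<bar>x\<bar>) \<le>
       C * (cmod (f x) powr enn2real (p x) * indicator {x. p x \<noteq> \<infinity>} x) + h x))"
    using admissible
  proof
    assume "esssup lebesgue p < \<infinity>"
    then obtain h where h: "integrable lborel h"
      and ae: "\<And>f. f \<in> borel_measurable lebesgue \<Longrightarrow> Lp_modular p f \<le> 1 \<Longrightarrow>
        AE x in lebesgue. p x \<noteq> \<infinity> \<and> cmod (f x) / (1 + \<bar>x\<bar>) \<le> cmod (f x) powr enn2real (p x) + h x"
      using pointwise_weight_bound_bounded_exponent by blast
    show ?thesis
      by (rule exI[of _ 1], rule exI[of _ h]) (auto simp: h elim!: eventually_mono dest!: ae)
  qed (rule pointwise_weight_bound_log_Hoelder)
  then obtain C h where C: "0 \<le> C" and h: "integrable lborel h"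
    and ae: "\<And>f. f \<in> borel_measurable lebesgue \<Longrightarrow> Lp_modular p f \<le> 1 \<Longrightarrow>
      AE x in lebesgue. cmod (f x) / (1 + \<bar>x\<bar>) \<le>
       C * (cmod (f x) powr enn2real (p x) * indicator {x. p x \<noteq> \<infinity>} x) + h x"
    by blast
  have h_fin: "(\<integral>\<^sup>+x. ennreal (norm (h x)) \<partial>lebesgue) = ennreal (LINT x|lborel. norm (h x))"
    using h by (simp add: nn_integral_completion nn_integral_eq_integral)
  note [measurable] = ident_measurable_lebesgue
  have [measurable]: "h \<in> borel_measurable lebesgue"
    using h by (auto intro: measurable_completion)
  have "(\<integral>\<^sup>+x. ennreal (cmod (f x) / (1 + \<bar>x\<bar>)) \<partial>lebesgue) \<le> ennreal (C + (LINT x|lborel. norm (h x)))"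
    if f [measurable]: "f \<in> borel_measurable lebesgue" and le1: "Lp_modular p f \<le> 1" for f
  proof -
    have fin: "finite_part f \<le> 1"
      using le1 by (auto simp: Lp_modular_split intro: order_trans[rotated])
    have "(\<integral>\<^sup>+x. ennreal (cmod (f x) / (1 + \<bar>x\<bar>)) \<partial>lebesgue)
      \<le> (\<integral>\<^sup>+x. ennreal C * (ennreal (cmod (f x) powr enn2real (p x)) * indicator {x. p x \<noteq> \<infinity>} x)
            + ennreal (norm (h x)) \<partial>lebesgue)"
    proof (rule nn_integral_mono_AE, use ae[OF f le1] in eventually_elim)
      case (elim x)
      let ?A = "cmod (f x) powr enn2real (p x) * indicator {x. p x \<noteq> \<infinity>} x"
      have "ennreal (cmod (f x) / (1 + \<bar>x\<bar>)) \<le> ennreal (C * ?A + norm (h x))"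
        using elim by (intro ennreal_leI) auto
      also have "\<dots> = ennreal C * (ennreal (cmod (f x) powr enn2real (p x)) * indicator {x. p x \<noteq> \<infinity>} x)
            + ennreal (norm (h x))"
        using C by (simp add: ennreal_mult' indicator_def)
      finally show ?case .
    qed
    also have "\<dots> = ennreal C * finite_part f + ennreal (LINT x|lborel. norm (h x))"
      unfolding finite_part_def 
      by (subst nn_integral_add, measurable, subst nn_integral_cmult, measurable, simp only: h_fin)
    also have "\<dots> \<le> ennreal C * 1 + ennreal (LINT x|lborel. norm (h x))"
      using fin by (intro add_mono mult_left_mono) auto
    also have "\<dots> = ennreal (C + (LINT x|lborel. norm (h x)))"
      using C by simp
    finally show ?thesis .
  qed
  then show ?thesis
    using C by (intro exI[of _ "C + (LINT x|lborel. norm (h x))"]) auto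
qed

lemma Lp_weighted_L1:
  obtains K where "0 \<le> K"
    "\<And>f. f \<in> Lp_functions p \<Longrightarrow>
       (\<integral>\<^sup>+x. ennreal (cmod (f x) / (1 + \<bar>x\<bar>)) \<partial>lebesgue) \<le> ennreal (K * Lp_norm p f)"
proof -
  obtain K where K: "0 \<le> K" and bound: "\<And>f. f \<in> borel_measurable lebesgue \<Longrightarrow> Lp_modular p f \<le> 1 \<Longrightarrow>
     (\<integral>\<^sup>+x. ennreal (cmod (f x) / (1 + \<bar>x\<bar>)) \<partial>lebesgue) \<le> ennreal K"
    using Lp_weighted_L1_modular by blast
  show ?thesis
  proof (rule that[OF K])
    fix f assume f: "f \<in> Lp_functions p"
    note [measurable] = Lp_functions_measurable[OF f] ident_measurable_lebesgue
    let ?J = "\<integral>\<^sup>+x. ennreal (cmod (f x) / (1 + \<bar>x\<bar>)) \<partial>lebesgue"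
    have le: "?J \<le> ennreal (K * c)" if c: "Lp_norm p f < c" for c
    proof -
      have c0: "0 < c" using Lp_norm_nonneg[OF f] c by linarith
      have "?J = (\<integral>\<^sup>+x. ennreal c * ennreal (cmod (f x / of_real c) / (1 + \<bar>x\<bar>)) \<partial>lebesgue)"
        using c0 by (intro nn_integral_cong) (simp add: ennreal_mult'[symmetric] norm_divide)
      also have "\<dots> = ennreal c * (\<integral>\<^sup>+x. ennreal (cmod (f x / of_real c) / (1 + \<bar>x\<bar>)) \<partial>lebesgue)"
        by (rule nn_integral_cmult) measurable
      also have "\<dots> \<le> ennreal c * ennreal K"
        by (intro mult_left_mono bound Lp_modular_le_1[OF f c]) auto
      finally show ?thesis using c0 K by (simp add: ennreal_mult'[symmetric] mult.commute)
    qed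
    from le[of "Lp_norm p f + 1"] have fin: "?J < \<infinity>" by (auto intro: le_less_trans)
    have "enn2real ?J \<le> K * Lp_norm p f"
    proof (rule field_le_epsilon)
      fix e :: real assume e: "0 < e"
      \<comment> \<open>Division by \<open>K + 1\<close> rather than \<open>K\<close> covers the case \<open>K = 0\<close>.\<close>
      have "Lp_norm p f < Lp_norm p f + e / (K + 1)" using e K by simp
      from le[OF this] have "enn2real ?J \<le> K * (Lp_norm p f + e / (K + 1))"
        using K e Lp_norm_nonneg[OF f] by (intro enn2real_leI) auto
      also have "\<dots> = K * Lp_norm p f + e * (K / (K + 1))" by (simp add: distrib_left)
      also have "\<dots> \<le> K * Lp_norm p f + e * 1"
        using K e by (intro add_left_mono mult_left_mono) auto
      finally show "enn2real ?J \<le> K * Lp_norm p f + e" by simp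
    qed
    then have "ennreal (enn2real ?J) \<le> ennreal (K * Lp_norm p f)" by (rule ennreal_leI)
    with fin show "?J \<le> ennreal (K * Lp_norm p f)" by simp
  qed
qed

end

section \<open>Completeness\<close>

text \<open>The Riesz--Fischer argument: the increments of the sequence are absolutely summable almost
  everywhere because the weighted sum of their moduli has a finite integral.\<close>

lemma AE_convergent_if_weighted_L1_summable:
  fixes v :: "nat \<Rightarrow> real \<Rightarrow> complex" and w :: "real \<Rightarrow> real"
  assumes v [measurable]: "\<And>k. v k \<in> borel_measurable M" and w [measurable]: "w \<in> borel_measurable M"
    and w_pos: "\<And>x. 0 < w x"
    and fin: "(\<Sum>k. \<integral>\<^sup>+x. ennreal (cmod (v (Suc k) x - v k x) * w x) \<partial>M) < \<infinity>"
  shows "AE x in M. convergent (\<lambda>k. v k x)"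
proof -
  have "(\<integral>\<^sup>+x. (\<Sum>k. ennreal (cmod (v (Suc k) x - v k x) * w x)) \<partial>M) < \<infinity>"
    using fin by (subst nn_integral_suminf) auto
  then have "AE x in M. (\<Sum>k. ennreal (cmod (v (Suc k) x - v k x) * w x)) \<noteq> \<infinity>"
    by (intro nn_integral_noteq_infinite) auto
  then show ?thesis
  proof eventually_elim
    case (elim x)
    have "summable (\<lambda>k. cmod (v (Suc k) x - v k x) * w x)"
      using elim w_pos[of x] by (intro summable_suminf_not_top) (auto intro: less_imp_le)
    then have "summable (\<lambda>k. cmod (v (Suc k) x - v k x))"
      using summable_mult2[of "\<lambda>k. cmod (v (Suc k) x - v k x) * w x" "1 / w x"] w_pos[of x] by simp
    then have "summable (\<lambda>k. v (Suc k) x - v k x)" by (rule summable_norm_cancel)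
    then obtain l where "(\<lambda>n. \<Sum>k<n. v (Suc k) x - v k x) \<longlonglongrightarrow> l"
      by (auto simp: summable_def sums_def)
    then have "(\<lambda>n. v n x - v 0 x) \<longlonglongrightarrow> l"
      by (simp only: sum_lessThan_telescope[of "\<lambda>k. v k x"])
    then have "(\<lambda>n. (v n x - v 0 x) + v 0 x) \<longlonglongrightarrow> l + v 0 x" by (intro tendsto_intros)
    then show ?case by (auto simp: convergent_def)
  qed
qed

context admissible_exponent
begin

text \<open>A function of norm 0 has weighted integral 0 by the embedding, and the weight is positive.\<close>

lemma Lp_norm_eq_0_iff:
  assumes f: "f \<in> Lp_functions p"
  shows "Lp_norm p f = 0 \<longleftrightarrow> (AE x in lebesgue. f x = 0)"
proof
  assume 0: "Lp_norm p f = 0"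
  note [measurable] = Lp_functions_measurable[OF f] ident_measurable_lebesgue
  obtain K where "(\<integral>\<^sup>+x. ennreal (cmod (f x) / (1 + \<bar>x\<bar>)) \<partial>lebesgue) \<le> ennreal (K * Lp_norm p f)"
    using Lp_weighted_L1 f by metis
  then have "(\<integral>\<^sup>+x. ennreal (cmod (f x) / (1 + \<bar>x\<bar>)) \<partial>lebesgue) = 0" using 0 by simp
  then have "AE x in lebesgue. ennreal (cmod (f x) / (1 + \<bar>x\<bar>)) = 0"
    by (subst (asm) nn_integral_0_iff_AE) auto
  then show "AE x in lebesgue. f x = 0"
    by eventually_elim (auto simp: divide_le_0_iff add_nonneg_eq_0_iff)
next
  assume "AE x in lebesgue. f x = 0"
  then show "Lp_norm p f = 0"
    using Lp_norm_cong_AE[OF f zero_in_Lp_functions] by (simp add: Lp_norm_zero)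
qed

lemma Lp_complete:
  assumes u: "\<And>n. u n \<in> Lp_functions p"
    and cauchy: "\<And>e. e > 0 \<Longrightarrow> \<exists>N. \<forall>m\<ge>N. \<forall>n\<ge>N. Lp_norm p (\<lambda>x. u m x - u n x) < e"
  shows "\<exists>f\<in>Lp_functions p. (\<lambda>n. Lp_norm p (\<lambda>x. u n x - f x)) \<longlonglongrightarrow> 0"
proof -
  note [measurable] = Lp_functions_measurable[OF u] ident_measurable_lebesgue
  obtain K where K: "0 \<le> K" and L1: "\<And>f. f \<in> Lp_functions p \<Longrightarrow>
       (\<integral>\<^sup>+x. ennreal (cmod (f x) / (1 + \<bar>x\<bar>)) \<partial>lebesgue) \<le> ennreal (K * Lp_norm p f)"
    using Lp_weighted_L1 by blast
  have "\<exists>N. \<forall>m\<ge>N. \<forall>n\<ge>N. Lp_norm p (\<lambda>x. u m x - u n x) < (1/2)^k" for k :: nat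
    by (rule cauchy) simp
  then obtain M where M: "\<And>k m n. M k \<le> m \<Longrightarrow> M k \<le> n \<Longrightarrow> Lp_norm p (\<lambda>x. u m x - u n x) < (1/2)^k"
    by metis
  \<comment> \<open>Monotone majorant of \<open>M\<close>: two successive members of the subsequence both lie beyond \<open>M k\<close>.\<close>
  define r where "r k = k + (\<Sum>i\<le>k. M i)" for k
  have r: "M k \<le> r k" "M k \<le> r (Suc k)" "k \<le> r k" for k
    using member_le_sum[of k "{..k}" M] by (auto simp: r_def)
  define v where "v k = u (r k)" for k
  have v [measurable]: "v k \<in> borel_measurable lebesgue" for k by (simp add: v_def)
  have "(\<Sum>k. \<integral>\<^sup>+x. ennreal (cmod (v (Suc k) x - v k x) * (1 / (1 + \<bar>x\<bar>))) \<partial>lebesgue)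
      \<le> (\<Sum>k. ennreal (K * (1/2)^k))"
  proof (intro suminf_le allI)
    fix k
    have "(\<integral>\<^sup>+x. ennreal (cmod (v (Suc k) x - v k x) * (1 / (1 + \<bar>x\<bar>))) \<partial>lebesgue)
      \<le> ennreal (K * Lp_norm p (\<lambda>x. v (Suc k) x - v k x))"
      using L1[OF Lp_functions_diff[OF u u]] by (simp add: v_def)
    also have "\<dots> \<le> ennreal (K * (1/2)^k)"
      unfolding v_def using K r by (intro ennreal_leI mult_left_mono less_imp_le[OF M]) auto
    finally show "(\<integral>\<^sup>+x. ennreal (cmod (v (Suc k) x - v k x) * (1 / (1 + \<bar>x\<bar>))) \<partial>lebesgue) \<le> ennreal (K * (1/2)^k)" .
  qed auto
  also have "\<dots> = ennreal (\<Sum>k. K * (1/2)^k)"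
    using K by (intro suminf_ennreal2 summable_mult summable_geometric) auto
  also have "\<dots> < \<infinity>" by simp
  finally have "AE x in lebesgue. convergent (\<lambda>k. v k x)"
    by (intro AE_convergent_if_weighted_L1_summable[where w = "\<lambda>x. 1 / (1 + \<bar>x\<bar>)"]) auto
  define f where "f x = lim (\<lambda>k. v k x)" for x
  have lim: "AE x in lebesgue. (\<lambda>k. v k x) \<longlonglongrightarrow> f x"
    using \<open>AE x in lebesgue. convergent (\<lambda>k. v k x)\<close>
    by eventually_elim (simp add: f_def convergent_LIMSEQ_iff)
  have f [measurable]: "f \<in> borel_measurable lebesgue"
    unfolding f_def by (rule borel_measurable_lim_metric) measurable
  have key: "\<exists>N. \<forall>n\<ge>N. Lp_modular p (\<lambda>x. (u n x - f x) / of_real (2 * e)) \<le> 1" if e: "0 < e" for e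
  proof -
    obtain N where N: "\<And>m n. N \<le> m \<Longrightarrow> N \<le> n \<Longrightarrow> Lp_norm p (\<lambda>x. u m x - u n x) < e"
      using cauchy[OF e] by blast
    have "Lp_modular p (\<lambda>x. (u n x - f x) / of_real (2 * e)) \<le> 1" if n: "N \<le> n" for n
    proof -
      \<comment> \<open>The shift by \<open>N\<close> places every member of the subsequence in the range of the Cauchy estimate.\<close>
      let ?h = "\<lambda>m x. (u n x - v (m + N) x) / of_real e"
      have "Lp_modular p (?h m) \<le> 1" for m
        unfolding v_def using n r(3)[of "m + N"]
        by (intro Lp_modular_le_1 Lp_functions_diff u N) auto
      moreover have "AE x in lebesgue. (\<lambda>m. ?h m x) \<longlonglongrightarrow> (u n x - f x) / of_real e"
        using lim by eventually_elim
          (use e in \<open>auto intro!: tendsto_intros dest: LIMSEQ_ignore_initial_segment\<close>)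
      ultimately have "Lp_modular p (\<lambda>x. of_real (1/2) * ((u n x - f x) / of_real e)) \<le> 1"
        by (intro Lp_modular_half_limit[where h = ?h]) auto
      moreover have "(\<lambda>x. of_real (1/2) * ((u n x - f x) / of_real e)) = (\<lambda>x. (u n x - f x) / of_real (2 * e))"
        by auto
      ultimately show ?thesis by simp
    qed
    then show ?thesis by blast
  qed
  \<comment> \<open>A single index with finite distance to the limit already puts the limit into the space.\<close>
  obtain n where "Lp_modular p (\<lambda>x. (u n x - f x) / of_real (2 * 1)) \<le> 1"
    using key[of 1] by auto
  then have "(\<lambda>x. u n x - f x) \<in> Lp_functions p" by (intro Lp_functionsI[of _ "2 * 1"]) auto
  from Lp_functions_diff[OF u[of n] this] have fL: "f \<in> Lp_functions p" by simp
  have "(\<lambda>n. Lp_norm p (\<lambda>x. u n x - f x)) \<longlonglongrightarrow> 0"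
  proof (rule LIMSEQ_I)
    fix e :: real assume e: "0 < e"
    then obtain N where "\<forall>n\<ge>N. Lp_modular p (\<lambda>x. (u n x - f x) / of_real (2 * (e/4))) \<le> 1"
      using key[of "e/4"] by auto
    then have "\<forall>n\<ge>N. Lp_norm p (\<lambda>x. u n x - f x) \<le> 2 * (e/4)"
      using e by (intro allI impI Lp_norm_le) auto
    then show "\<exists>N. \<forall>n\<ge>N. norm (Lp_norm p (\<lambda>x. u n x - f x) - 0) < e"
      using e Lp_norm_nonneg[OF Lp_functions_diff[OF u fL]]
      by (intro exI[of _ N]) fastforce
  qed
  with fL show ?thesis by blast
qed

end

section \<open>Schwartz functions\<close>

lemma nth_deriv_0 [simp]: "nth_deriv 0 \<phi> = \<phi>"
  by (simp add: nth_deriv_def)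

lemma nth_deriv_Suc: "nth_deriv (Suc k) \<phi> = (\<lambda>x. vector_derivative (nth_deriv k \<phi>) (at x))"
  by (simp add: nth_deriv_def)

lemma schwartz_has_vector_derivative:
  assumes "\<phi> \<in> schwartz_functions"
  shows "(nth_deriv k \<phi> has_vector_derivative nth_deriv (Suc k) \<phi> x) (at x)"
  using assms by (auto simp: schwartz_functions_def nth_deriv_Suc vector_derivative_works)

text \<open>Identifies all derivatives at once from a sequence of functions in which each is the
  derivative of its predecessor.\<close>

lemma nth_deriv_eqI:
  assumes "D 0 = \<phi>" "\<And>k x. (D k has_vector_derivative D (Suc k) x) (at x)"
  shows "nth_deriv k \<phi> = D k"
proof (induction k)
  case (Suc k)
  then show ?case using assms(2) by (auto simp: nth_deriv_Suc vector_derivative_at)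
qed (simp add: assms)

lemma schwartz_functionsI:
  assumes "D 0 = \<phi>" "\<And>k x. (D k has_vector_derivative D (Suc k) x) (at x)"
    and "\<And>j k. \<exists>B. \<forall>x. \<bar>x\<bar> ^ j * cmod (D k x) \<le> B"
  shows "\<phi> \<in> schwartz_functions"
proof -
  have "nth_deriv k \<phi> = D k" for k using assms by (intro nth_deriv_eqI)
  then show ?thesis
    unfolding schwartz_functions_def bdd_above_def using assms(2,3)
    by (auto intro: differentiableI_vector)
qed

lemma schwartz_seminorm_bound:
  assumes "\<phi> \<in> schwartz_functions"
  shows "\<bar>x\<bar> ^ j * cmod (nth_deriv k \<phi> x) \<le> schwartz_seminorm j k \<phi>"
  unfolding schwartz_seminorm_def using assms
  by (intro cSUP_upper) (auto simp: schwartz_functions_def)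

lemma schwartz_seminorm_nonneg:
  assumes "\<phi> \<in> schwartz_functions"
  shows "0 \<le> schwartz_seminorm j k \<phi>"
  using schwartz_seminorm_bound[OF assms, where x = 0 and j = j and k = k]
  by (rule order_trans[rotated]) simp

lemma schwartz_continuous:
  assumes "\<phi> \<in> schwartz_functions"
  shows "isCont (nth_deriv k \<phi>) x"
  using schwartz_has_vector_derivative[OF assms] has_vector_derivative_continuous by blast

lemma schwartz_borel [measurable]:
  "\<phi> \<in> schwartz_functions \<Longrightarrow> nth_deriv k \<phi> \<in> borel_measurable borel"
  by (intro borel_measurable_continuous_onI continuous_at_imp_continuous_on ballI schwartz_continuous)

lemma nth_deriv_add:
  assumes "\<phi> \<in> schwartz_functions" "\<psi> \<in> schwartz_functions"
  shows "nth_deriv k (\<lambda>x. \<phi> x + \<psi> x) = (\<lambda>x. nth_deriv k \<phi> x + nth_deriv k \<psi> x)"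
  by (rule nth_deriv_eqI[where D = "\<lambda>k x. nth_deriv k \<phi> x + nth_deriv k \<psi> x"])
    (auto intro!: derivative_intros schwartz_has_vector_derivative assms)

lemma nth_deriv_scale:
  assumes "\<phi> \<in> schwartz_functions"
  shows "nth_deriv k (\<lambda>x. a * \<phi> x) = (\<lambda>x. a * nth_deriv k \<phi> x)"
  by (rule nth_deriv_eqI[where D = "\<lambda>k x. a * nth_deriv k \<phi> x"])
    (auto intro!: derivative_eq_intros schwartz_has_vector_derivative assms)

lemma schwartz_add:
  assumes "\<phi> \<in> schwartz_functions" "\<psi> \<in> schwartz_functions"
  shows "(\<lambda>x. \<phi> x + \<psi> x) \<in> schwartz_functions"
proof (rule schwartz_functionsI[where D = "\<lambda>k x. nth_deriv k \<phi> x + nth_deriv k \<psi> x"])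
  fix j k
  show "\<exists>B. \<forall>x. \<bar>x\<bar> ^ j * cmod (nth_deriv k \<phi> x + nth_deriv k \<psi> x) \<le> B"
  proof (intro exI allI)
    fix x
    have "\<bar>x\<bar> ^ j * cmod (nth_deriv k \<phi> x + nth_deriv k \<psi> x)
        \<le> \<bar>x\<bar> ^ j * cmod (nth_deriv k \<phi> x) + \<bar>x\<bar> ^ j * cmod (nth_deriv k \<psi> x)"
      by (simp add: norm_triangle_ineq mult_left_mono flip: distrib_left)
    also have "\<dots> \<le> schwartz_seminorm j k \<phi> + schwartz_seminorm j k \<psi>"
      by (intro add_mono schwartz_seminorm_bound assms)
    finally show "\<bar>x\<bar> ^ j * cmod (nth_deriv k \<phi> x + nth_deriv k \<psi> x)
        \<le> schwartz_seminorm j k \<phi> + schwartz_seminorm j k \<psi>" .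
  qed
qed (auto intro!: derivative_intros schwartz_has_vector_derivative assms)

lemma schwartz_scale:
  assumes "\<phi> \<in> schwartz_functions"
  shows "(\<lambda>x. a * \<phi> x) \<in> schwartz_functions"
proof (rule schwartz_functionsI[where D = "\<lambda>k x. a * nth_deriv k \<phi> x"])
  fix j k
  have "\<bar>x\<bar> ^ j * cmod (a * nth_deriv k \<phi> x) \<le> cmod a * schwartz_seminorm j k \<phi>" for x
    using mult_left_mono[OF schwartz_seminorm_bound[OF assms, of x j k], of "cmod a"]
    by (simp add: norm_mult mult.left_commute)
  then show "\<exists>B. \<forall>x. \<bar>x\<bar> ^ j * cmod (a * nth_deriv k \<phi> x) \<le> B" by blast
qed (auto intro!: derivative_eq_intros schwartz_has_vector_derivative assms)

text \<open>The power \<open>(1 + |s|)\<^sup>3\<close> leaves the integrable factor \<open>(1 + |s|) powr (-2)\<close> once one power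
  has been spent on the linear growth of \<open>Psi f\<close>.\<close>

lemma schwartz_decay:
  assumes "\<phi> \<in> schwartz_functions"
  shows "(1 + \<bar>s\<bar>) * cmod (nth_deriv k \<phi> s)
    \<le> 3 * (\<Sum>j\<le>3. schwartz_seminorm j k \<phi>) * (1 + \<bar>s\<bar>) powr (-2)"
proof -
  let ?d = "cmod (nth_deriv k \<phi> s)"
  note b = schwartz_seminorm_bound[OF assms, of s _ k]
  have "(1 + \<bar>s\<bar>) ^ 3 * ?d = \<bar>s\<bar>^0 * ?d + 3 * (\<bar>s\<bar>^1 * ?d) + 3 * (\<bar>s\<bar>^2 * ?d) + \<bar>s\<bar>^3 * ?d"
    by (simp add: power3_eq_cube power2_eq_square algebra_simps)
  also have "\<dots> \<le> 3 * (\<Sum>j\<le>3. schwartz_seminorm j k \<phi>)"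
    using b[of 0] b[of 1] b[of 2] b[of 3]
      schwartz_seminorm_nonneg[OF assms, of 0 k] schwartz_seminorm_nonneg[OF assms, of 3 k]
    by (simp add: numeral_3_eq_3 numeral_2_eq_2)
  finally have "(1 + \<bar>s\<bar>) ^ 3 * ?d * (1 + \<bar>s\<bar>) powr (-2)
      \<le> 3 * (\<Sum>j\<le>3. schwartz_seminorm j k \<phi>) * (1 + \<bar>s\<bar>) powr (-2)"
    by (intro mult_right_mono) auto
  moreover have "(1 + \<bar>s\<bar>) ^ 3 * (1 + \<bar>s\<bar>) powr (-2) = 1 + \<bar>s\<bar>"
    using powr_add[of "1 + \<bar>s\<bar>" 3 "-2"] by simp
  then have "(1 + \<bar>s\<bar>) ^ 3 * ?d * (1 + \<bar>s\<bar>) powr (-2) = (1 + \<bar>s\<bar>) * ?d"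
    by (metis mult.assoc mult.commute)
  ultimately show ?thesis by (simp only:)
qed

lemma schwartz_integrable_weighted:
  assumes "\<phi> \<in> schwartz_functions"
  shows "integrable lborel (\<lambda>s. (1 + \<bar>s\<bar>) * cmod (nth_deriv k \<phi> s))"
proof (rule Bochner_Integration.integrable_bound)
  show "integrable lborel (\<lambda>s. 3 * (\<Sum>j\<le>3. schwartz_seminorm j k \<phi>) * (1 + \<bar>s\<bar>) powr (-2))"
    using integrable_inverse_weight_powr[of 2] by (intro integrable_mult_right) auto
  show "(\<lambda>s. (1 + \<bar>s\<bar>) * cmod (nth_deriv k \<phi> s)) \<in> borel_measurable lborel"
    by (intro borel_measurable_times borel_measurable_norm) (use schwartz_borel[OF assms] in simp_all)
  show "AE s in lborel. norm ((1 + \<bar>s\<bar>) * cmod (nth_deriv k \<phi> s))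
     \<le> norm (3 * (\<Sum>j\<le>3. schwartz_seminorm j k \<phi>) * (1 + \<bar>s\<bar>) powr (-2))"
  proof (intro always_eventually allI)
    fix s
    have "norm ((1 + \<bar>s\<bar>) * cmod (nth_deriv k \<phi> s)) = (1 + \<bar>s\<bar>) * cmod (nth_deriv k \<phi> s)"
      by simp
    also have "\<dots> \<le> 3 * (\<Sum>j\<le>3. schwartz_seminorm j k \<phi>) * (1 + \<bar>s\<bar>) powr (-2)"
      by (rule schwartz_decay[OF assms])
    finally show "norm ((1 + \<bar>s\<bar>) * cmod (nth_deriv k \<phi> s))
        \<le> norm (3 * (\<Sum>j\<le>3. schwartz_seminorm j k \<phi>) * (1 + \<bar>s\<bar>) powr (-2))"
      by (rule order_trans) (simp only: real_norm_def abs_ge_self)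
  qed
qed

lemma schwartz_integrable:
  assumes "\<phi> \<in> schwartz_functions"
  shows "integrable lborel (nth_deriv k \<phi>)"
proof (rule Bochner_Integration.integrable_bound[OF schwartz_integrable_weighted[OF assms, of k]])
  have "cmod (nth_deriv k \<phi> s) \<le> (1 + \<bar>s\<bar>) * cmod (nth_deriv k \<phi> s)" for s
    by (simp add: distrib_right)
  then show "AE s in lborel. cmod (nth_deriv k \<phi> s) \<le> norm ((1 + \<bar>s\<bar>) * cmod (nth_deriv k \<phi> s))"
    by simp
qed (use schwartz_borel[OF assms] in simp)

lemma schwartz_tendsto_0:
  assumes "\<phi> \<in> schwartz_functions"
  shows "(\<phi> \<longlongrightarrow> 0) at_infinity"
proof (rule Lim_null_comparison)
  show "\<forall>\<^sub>F x in at_infinity. norm (\<phi> x) \<le> schwartz_seminorm 1 0 \<phi> * inverse (norm x)"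
    unfolding eventually_at_infinity
  proof (intro exI[of _ 1] allI impI)
    fix x :: real assume "1 \<le> norm x"
    then show "norm (\<phi> x) \<le> schwartz_seminorm 1 0 \<phi> * inverse (norm x)"
      using schwartz_seminorm_bound[OF assms, of x 1 0] by (simp add: field_simps)
  qed
  have "((\<lambda>x::real. inverse (norm x)) \<longlongrightarrow> 0) at_infinity"
    by (intro tendsto_inverse_0_at_top filterlim_norm_at_top)
  from tendsto_mult_left[OF this, of "schwartz_seminorm 1 0 \<phi>"]
  show "((\<lambda>x::real. schwartz_seminorm 1 0 \<phi> * inverse (norm x)) \<longlongrightarrow> 0) at_infinity"
    by simp
qed

lemma power_le_fact_exp: "0 \<le> y \<Longrightarrow> y ^ n \<le> fact n * exp (y :: real)"
proof -
  assume y: "0 \<le> y"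
  have "y ^ n / fact n \<le> exp y"
    using sum_le_suminf[OF summable_exp_generic[of y], of "{n}"] y
    by (simp add: exp_def divide_inverse mult.commute)
  then show ?thesis by (simp add: field_simps)
qed

text \<open>Monomials suffice, and for them \<open>|y|\<^sup>n \<le> n! exp|y|\<close> while \<open>|y| - y\<^sup>2/2 \<le> 1/2\<close>.\<close>

lemma poly_gauss_bounded:
  fixes P :: "real poly"
  shows "\<exists>B. \<forall>y. \<bar>poly P y\<bar> * exp (- y\<^sup>2 / 2) \<le> B"
proof (intro exI allI)
  fix y :: real
  have mono: "\<bar>y\<bar> ^ i * exp (- y\<^sup>2 / 2) \<le> fact i * exp (1/2)" for i
  proof -
    have "\<bar>y\<bar> ^ i * exp (- y\<^sup>2 / 2) \<le> (fact i * exp \<bar>y\<bar>) * exp (- y\<^sup>2 / 2)"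
      by (intro mult_right_mono power_le_fact_exp) auto
    also have "\<dots> = fact i * exp (\<bar>y\<bar> - y\<^sup>2 / 2)" by (simp add: exp_add[symmetric])
    also have "\<bar>y\<bar> - y\<^sup>2 / 2 \<le> 1/2"
      using zero_le_power2[of "\<bar>y\<bar> - 1"] by (simp add: power2_diff)
    finally show ?thesis by simp
  qed
  have "\<bar>poly P y\<bar> * exp (- y\<^sup>2 / 2) \<le> (\<Sum>i\<le>degree P. \<bar>coeff P i\<bar> * \<bar>y\<bar> ^ i) * exp (- y\<^sup>2 / 2)"
    unfolding poly_altdef
    by (intro mult_right_mono order_trans[OF sum_abs]) (auto simp: abs_mult power_abs)
  also have "\<dots> = (\<Sum>i\<le>degree P. \<bar>coeff P i\<bar> * (\<bar>y\<bar> ^ i * exp (- y\<^sup>2 / 2)))"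
    by (simp add: sum_distrib_right mult.assoc)
  also have "\<dots> \<le> (\<Sum>i\<le>degree P. \<bar>coeff P i\<bar> * (fact i * exp (1/2)))"
    by (intro sum_mono mult_left_mono mono) auto
  finally show "\<bar>poly P y\<bar> * exp (- y\<^sup>2 / 2) \<le> (\<Sum>i\<le>degree P. \<bar>coeff P i\<bar> * (fact i * exp (1/2)))" .
qed

text \<open>The translation parameter of the test function becomes the frequency after a Fourier transform.\<close>

definition gaussian :: "real \<Rightarrow> real \<Rightarrow> complex" where
  "gaussian \<xi> s = complex_of_real (exp (- (s + \<xi>)\<^sup>2 / 2))"

text \<open>Each derivative is a polynomial times the Gaussian; up to sign the polynomials are the Hermite
  polynomials.\<close>

lemma gaussian_schwartz: "gaussian \<xi> \<in> schwartz_functions"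
proof -
  \<comment> \<open>Differentiating \<open>P(y) exp(-y\<^sup>2/2)\<close> replaces \<open>P\<close> by \<open>P' - y P\<close>.\<close>
  define H :: "nat \<Rightarrow> real poly" where "H = rec_nat 1 (\<lambda>_ P. pderiv P - [:0, 1:] * P)"
  have H: "H 0 = 1" "H (Suc k) = pderiv (H k) - [:0, 1:] * H k" for k by (simp_all add: H_def)
  let ?D = "\<lambda>k s. complex_of_real (poly (H k) (s + \<xi>) * exp (- (s + \<xi>)\<^sup>2 / 2))"
  show ?thesis
  proof (rule schwartz_functionsI[where D = ?D])
    show "?D 0 = gaussian \<xi>" by (simp add: H gaussian_def fun_eq_iff)
    fix k x
    have "((\<lambda>s. poly (H k) (s + \<xi>) * exp (- (s + \<xi>)\<^sup>2 / 2)) has_real_derivative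
        poly (H (Suc k)) (x + \<xi>) * exp (- (x + \<xi>)\<^sup>2 / 2)) (at x)"
      by (auto intro!: derivative_eq_intros poly_DERIV[THEN DERIV_chain2] simp: H algebra_simps)
    then show "(?D k has_vector_derivative ?D (Suc k) x) (at x)"
      by (intro has_vector_derivative_of_real) (simp add: has_real_derivative_iff_has_vector_derivative)
  next
    fix j k
    \<comment> \<open>In the variable \<open>y = x + \<xi>\<close> the factor \<open>x\<close> is the polynomial \<open>y - \<xi>\<close>.\<close>
    obtain B where B: "\<And>y. \<bar>poly ([:- \<xi>, 1:] ^ j * H k) y\<bar> * exp (- y\<^sup>2 / 2) \<le> B"
      using poly_gauss_bounded by blast
    have "\<bar>x\<bar> ^ j * cmod (?D k x) \<le> B" for x
      using B[of "x + \<xi>"] by (simp add: norm_mult poly_power abs_mult power_abs mult.assoc del: of_real_mult)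
    then show "\<exists>B. \<forall>x. \<bar>x\<bar> ^ j * cmod (?D k x) \<le> B" by blast
  qed
qed

text \<open>Known from probability theory as the characteristic function of the standard normal
  distribution; translating the variable of integration produces the factor \<open>exp(i \<xi> t)\<close>.\<close>

lemma fourier_gaussian:
  "(LINT s|lborel. exp (- (\<i> * of_real s * of_real t)) * gaussian \<xi> s)
    = of_real (sqrt (2 * pi)) * exp (\<i> * of_real (\<xi> * t)) * of_real (exp (- t\<^sup>2 / 2))"
proof -
  have "of_real (exp (- t\<^sup>2 / 2)) = char std_normal_distribution (- t)"
    by (simp add: char_std_normal_distribution)
  also have "\<dots> = (LINT x|lborel. std_normal_density x *\<^sub>R iexp (- t * x))"
    unfolding char_def by (subst integral_density) auto
  also have "\<dots> = (LINT s|lborel. std_normal_density (\<xi> + 1 * s) *\<^sub>R iexp (- t * (\<xi> + 1 * s)))"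
    by (subst lborel_integral_real_affine[of 1 _ \<xi>]) auto
  also have "\<dots> = (LINT s|lborel. (of_real (1 / sqrt (2 * pi)) * exp (- (\<i> * of_real (\<xi> * t)))) *
      (exp (- (\<i> * of_real s * of_real t)) * gaussian \<xi> s))"
    by (intro Bochner_Integration.integral_cong refl)
      (simp add: std_normal_density_def gaussian_def scaleR_conv_of_real exp_of_real[symmetric]
        exp_add[symmetric] algebra_simps)
  also have "\<dots> = (of_real (1 / sqrt (2 * pi)) * exp (- (\<i> * of_real (\<xi> * t)))) *
      (LINT s|lborel. exp (- (\<i> * of_real s * of_real t)) * gaussian \<xi> s)"
    by (rule integral_mult_right_zero)
  finally show ?thesis
    by (simp add: field_simps exp_minus)
qed

section \<open>Uniqueness of the Fourier transform\<close>

text \<open>The positive and the negative part of the function have equal Fourier transforms, in particular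
  equal integrals. Unless these vanish, the normalised parts are densities of probability measures
  with the same characteristic function, so Levy's uniqueness theorem applies.\<close>

lemma real_fourier_transform_zero_imp_AE_zero:
  fixes g :: "real \<Rightarrow> real"
  assumes g: "integrable lborel g"
    and zero: "\<And>\<xi>. (LINT x|lborel. iexp (\<xi> * x) * complex_of_real (g x)) = 0"
  shows "AE x in lborel. g x = 0"
proof -
  have [measurable]: "g \<in> borel_measurable borel" using g by auto
  define gp where "gp x = max 0 (g x)" for x
  define gm where "gm x = max 0 (- g x)" for x
  have pm: "g x = gp x - gm x" "0 \<le> gp x" "0 \<le> gm x" "gp x \<le> norm (g x)" "gm x \<le> norm (g x)" for x
    by (auto simp: gp_def gm_def)
  have gpm [measurable]: "gp \<in> borel_measurable borel" "gm \<in> borel_measurable borel"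
    by (auto simp: gp_def[abs_def] gm_def[abs_def])
  have int: "integrable lborel gp" "integrable lborel gm"
    by (rule Bochner_Integration.integrable_bound[OF g]; use pm in auto)+
  have intc: "integrable lborel (\<lambda>x. iexp (\<xi> * x) * complex_of_real (h x))"
    if "integrable lborel h" for h \<xi>
    by (rule Bochner_Integration.integrable_bound[OF that]) (use that in \<open>auto simp: norm_mult\<close>)
  have eq: "(LINT x|lborel. iexp (\<xi> * x) * complex_of_real (gp x))
      = (LINT x|lborel. iexp (\<xi> * x) * complex_of_real (gm x))" for \<xi>
  proof -
    have "0 = (LINT x|lborel. iexp (\<xi> * x) * complex_of_real (gp x) - iexp (\<xi> * x) * complex_of_real (gm x))"
      using zero[of \<xi>] by (simp add: pm(1) algebra_simps)
    also have "\<dots> = (LINT x|lborel. iexp (\<xi> * x) * complex_of_real (gp x))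
      - (LINT x|lborel. iexp (\<xi> * x) * complex_of_real (gm x))"
      by (intro Bochner_Integration.integral_diff intc int)
    finally show ?thesis by simp
  qed
  define m where "m = (LINT x|lborel. gp x)"
  have "complex_of_real (LINT x|lborel. gp x) = complex_of_real (LINT x|lborel. gm x)"
    using eq[of 0] by simp
  then have m: "(LINT x|lborel. gm x) = m" by (simp only: m_def of_real_eq_iff)
  have m0: "0 \<le> m" unfolding m_def using pm by simp
  show ?thesis
  proof (cases "m = 0")
    case True
    have "AE x in lborel. gp x = 0" "AE x in lborel. gm x = 0"
      using integral_nonneg_eq_0_iff_AE[OF int(1)] integral_nonneg_eq_0_iff_AE[OF int(2)]
        True m pm by (auto simp: m_def)
    then show ?thesis by eventually_elim (simp add: pm(1))
  next
    case False
    with m0 have mpos: "0 < m" by simp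
    have dist: "real_distribution (density lborel (\<lambda>x. ennreal (h x / m)))"
      and char: "char (density lborel (\<lambda>x. ennreal (h x / m))) \<xi>
        = (LINT x|lborel. iexp (\<xi> * x) * complex_of_real (h x)) / of_real m"
      if h: "integrable lborel h" "(LINT x|lborel. h x) = m" "\<And>x. 0 \<le> h x" for h \<xi>
    proof -
      have [measurable]: "h \<in> borel_measurable borel" using h by auto
      have "(\<integral>\<^sup>+x. ennreal (h x / m) \<partial>lborel) = ennreal (LINT x|lborel. h x / m)"
        using h m0 by (intro nn_integral_eq_integral) auto
      also have "\<dots> = 1" using h mpos by simp
      finally show "real_distribution (density lborel (\<lambda>x. ennreal (h x / m)))"
        by (auto simp: real_distribution_def real_distribution_axioms_def emeasure_density
            intro!: prob_spaceI)
      have "char (density lborel (\<lambda>x. ennreal (h x / m))) \<xi>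
          = (LINT x|lborel. (h x / m) *\<^sub>R iexp (\<xi> * x))"
        unfolding char_def using h m0 by (subst integral_density) auto
      also have "\<dots> = (LINT x|lborel. iexp (\<xi> * x) * complex_of_real (h x) / of_real m)"
        by (intro Bochner_Integration.integral_cong) (auto simp: scaleR_conv_of_real)
      finally show "char (density lborel (\<lambda>x. ennreal (h x / m))) \<xi>
        = (LINT x|lborel. iexp (\<xi> * x) * complex_of_real (h x)) / of_real m" by simp
    qed
    have "density lborel (\<lambda>x. ennreal (gp x / m)) = density lborel (\<lambda>x. ennreal (gm x / m))"
    proof (rule Levy_uniqueness)
      show "char (density lborel (\<lambda>x. ennreal (gp x / m))) = char (density lborel (\<lambda>x. ennreal (gm x / m)))"
        using char[OF int(1) m_def[symmetric] pm(2)] char[OF int(2) m pm(3)] eq by auto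
    qed (rule dist[OF int(1) m_def[symmetric] pm(2)] dist[OF int(2) m pm(3)])+
    then have "AE x in lborel. ennreal (gp x / m) = ennreal (gm x / m)"
      by (intro sigma_finite_measure.density_unique[OF sigma_finite_lborel]) auto
    then show ?thesis
      
    proof eventually_elim
      case (elim x)
      then show ?case using mpos pm[of x] by simp
    qed
  qed
qed

text \<open>The Fourier transform of the complex conjugate at \<open>\<xi>\<close> is the conjugate of the transform at
  \<open>-\<xi>\<close>. Hence the transforms of real and imaginary part vanish too.\<close>

lemma fourier_transform_zero_imp_AE_zero:
  fixes g :: "real \<Rightarrow> complex"
  assumes g: "integrable lborel g"
    and zero: "\<And>\<xi>. (LINT x|lborel. iexp (\<xi> * x) * g x) = 0"
  shows "AE x in lborel. g x = 0"
proof -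
  have [measurable]: "g \<in> borel_measurable borel" using g by auto
  have int: "integrable lborel (\<lambda>x. iexp (\<xi> * x) * h x)" if "integrable lborel h" for h \<xi>
    by (rule Bochner_Integration.integrable_bound[OF that]) (use that in \<open>auto simp: norm_mult\<close>)
  have gc: "integrable lborel (\<lambda>x. cnj (g x))" using g by simp
  have cnj0: "(LINT x|lborel. iexp (\<xi> * x) * cnj (g x)) = 0" for \<xi>
  proof -
    have "(LINT x|lborel. iexp (\<xi> * x) * cnj (g x)) = (LINT x|lborel. cnj (iexp (- \<xi> * x) * g x))"
      by (intro Bochner_Integration.integral_cong) (auto simp: exp_cnj)
    also have "\<dots> = cnj (LINT x|lborel. iexp (- \<xi> * x) * g x)" by (rule Bochner_Integration.integral_cnj)
    also have "\<dots> = 0" by (simp only: zero complex_cnj_zero)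
    finally show ?thesis .
  qed
  have "AE x in lborel. Re (g x) = 0"
  proof (rule real_fourier_transform_zero_imp_AE_zero)
    fix \<xi>
    have "(LINT x|lborel. iexp (\<xi> * x) * complex_of_real (Re (g x)))
      = (LINT x|lborel. (1/2) * (iexp (\<xi> * x) * g x + iexp (\<xi> * x) * cnj (g x)))"
      by (intro Bochner_Integration.integral_cong refl) (simp add: complex_add_cnj flip: distrib_left)
    also have "\<dots> = (1/2) * ((LINT x|lborel. iexp (\<xi> * x) * g x) + (LINT x|lborel. iexp (\<xi> * x) * cnj (g x)))"
      by (simp add: Bochner_Integration.integral_add int g gc del: of_real_mult)
    finally show "(LINT x|lborel. iexp (\<xi> * x) * complex_of_real (Re (g x))) = 0" using zero cnj0 by simp
  qed (use g in simp)
  moreover have im: "complex_of_real (Im z) = (1/(2*\<i>)) * (z - cnj z)" for z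
    by (simp add: complex_eq_iff)
  have "AE x in lborel. Im (g x) = 0"
  proof (rule real_fourier_transform_zero_imp_AE_zero)
    fix \<xi>
    have "(LINT x|lborel. iexp (\<xi> * x) * complex_of_real (Im (g x)))
      = (LINT x|lborel. (1/(2*\<i>)) * (iexp (\<xi> * x) * g x - iexp (\<xi> * x) * cnj (g x)))"
      by (simp only: im right_diff_distrib mult.left_commute)
    also have "\<dots> = (1/(2*\<i>)) * ((LINT x|lborel. iexp (\<xi> * x) * g x) - (LINT x|lborel. iexp (\<xi> * x) * cnj (g x)))"
      by (simp add: Bochner_Integration.integral_diff int g gc del: of_real_mult)
    finally show "(LINT x|lborel. iexp (\<xi> * x) * complex_of_real (Im (g x))) = 0" using zero cnj0 by simp
  qed (use g in simp)
  ultimately show ?thesis by eventually_elim (simp add: complex_eq_iff)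
qed

section \<open>The integrated Fourier transform on weighted L1 functions\<close>

definition Psi_kernel :: "real \<Rightarrow> real \<Rightarrow> complex" where
  "Psi_kernel s t = (1 - exp (- (\<i> * of_real s * of_real t))) / (\<i> * of_real t)"

lemma Psi_integrand_kernel: "Psi_integrand f s t = Psi_kernel s t * f t"
  by (simp add: Psi_integrand_def Psi_kernel_def)

lemma norm_unit_exp: "cmod (exp (- (\<i> * of_real s * of_real t))) = 1"
  by simp

text \<open>Combines \<open>|1 - exp(-ist)| \<le> |s t|\<close>, which is good near \<open>t = 0\<close>, with
  \<open>|1 - exp(-ist)| \<le> 2\<close>, which gives the decay. At \<open>t = 0\<close> the kernel is 0 by the convention on
  division.\<close>

lemma Psi_kernel_bound: "cmod (Psi_kernel s t) \<le> 2 * (1 + \<bar>s\<bar>) / (1 + \<bar>t\<bar>)"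
proof (cases "t = 0")
  case False
  have "cmod (iexp (- (s * t)) - 1) \<le> \<bar>s * t\<bar>"
    using iexp_approx1[of "- (s * t)" 0] by simp
  moreover have "cmod (1 - exp (- (\<i> * of_real s * of_real t))) = cmod (iexp (- (s * t)) - 1)"
    by (subst norm_minus_commute) (simp add: mult.assoc)
  ultimately have 1: "cmod (1 - exp (- (\<i> * of_real s * of_real t))) \<le> \<bar>s\<bar> * \<bar>t\<bar>" by (simp add: abs_mult)
  have 2: "cmod (1 - exp (- (\<i> * of_real s * of_real t))) \<le> 2"
    using norm_triangle_ineq4[of 1 "exp (- (\<i> * of_real s * of_real t))"] norm_unit_exp[of s t] by simp
  have "cmod (1 - exp (- (\<i> * of_real s * of_real t))) * (1 + \<bar>t\<bar>) \<le> \<bar>s\<bar> * \<bar>t\<bar> + 2 * \<bar>t\<bar>"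
    using 1 mult_right_mono[OF 2, of "\<bar>t\<bar>"] by (simp add: distrib_left)
  also have "\<dots> \<le> 2 * (1 + \<bar>s\<bar>) * \<bar>t\<bar>" by (simp add: algebra_simps)
  finally show ?thesis
    using False by (simp add: Psi_kernel_def norm_divide norm_mult field_simps)
qed (simp add: Psi_kernel_def)

lemma Psi_kernel_measurable_pair [measurable]:
  "(\<lambda>x. Psi_kernel (fst x) (snd x)) \<in> borel_measurable (borel \<Otimes>\<^sub>M borel)"
  unfolding Psi_kernel_def by measurable

lemma Psi_kernel_measurable [measurable]: "Psi_kernel s \<in> borel_measurable lebesgue"
proof -
  have "Psi_kernel s \<in> borel_measurable borel" unfolding Psi_kernel_def[abs_def] by measurable
  then show ?thesis by (intro measurable_completion) simp
qed

text \<open>The weight mirrors the decay of the kernel, which makes this a domain on which the integrated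
  Fourier transform converges absolutely.\<close>

definition weighted_L1 :: "(real \<Rightarrow> complex) \<Rightarrow> bool" where
  "weighted_L1 f \<longleftrightarrow> f \<in> borel_measurable lebesgue \<and> integrable lebesgue (\<lambda>t. cmod (f t) / (1 + \<bar>t\<bar>))"

lemma Psi_integrand_bound:
  "cmod (Psi_integrand f s t) \<le> 2 * (1 + \<bar>s\<bar>) * (cmod (f t) / (1 + \<bar>t\<bar>))"
  using mult_right_mono[OF Psi_kernel_bound[of s t], of "cmod (f t)"]
  by (simp add: Psi_integrand_kernel norm_mult)

lemma integrable_Psi_integrand:
  assumes "weighted_L1 f"
  shows "integrable lebesgue (Psi_integrand f s)"
proof (rule Bochner_Integration.integrable_bound)
  have [measurable]: "f \<in> borel_measurable lebesgue" using assms by (simp add: weighted_L1_def)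
  show "integrable lebesgue (\<lambda>t. 2 * (1 + \<bar>s\<bar>) * (cmod (f t) / (1 + \<bar>t\<bar>)))"
    using assms by (intro integrable_mult_right) (simp add: weighted_L1_def)
  have "Psi_integrand f s = (\<lambda>t. Psi_kernel s t * f t)" by (simp add: fun_eq_iff Psi_integrand_kernel)
  then show "Psi_integrand f s \<in> borel_measurable lebesgue" by simp
  show "AE t in lebesgue. norm (Psi_integrand f s t) \<le> norm (2 * (1 + \<bar>s\<bar>) * (cmod (f t) / (1 + \<bar>t\<bar>)))"
    by (intro always_eventually allI order_trans[OF Psi_integrand_bound]) (simp only: real_norm_def abs_ge_self)
qed

text \<open>At \<open>s = 0\<close> the integrand is identically 0, so the separate value in the definition agrees with
  the integral.\<close>

lemma Psi_eq_integral: "Psi f s = (LINT t|lebesgue. Psi_integrand f s t)"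
  by (simp add: Psi_def Psi_integrand_def)

lemma Psi_bound:
  assumes "weighted_L1 f"
  shows "cmod (Psi f s) \<le> 2 * (1 + \<bar>s\<bar>) * (LINT t|lebesgue. cmod (f t) / (1 + \<bar>t\<bar>))"
proof -
  have "cmod (Psi f s) \<le> (LINT t|lebesgue. cmod (Psi_integrand f s t))"
    unfolding Psi_eq_integral by (rule integral_norm_bound)
  also have "\<dots> \<le> (LINT t|lebesgue. 2 * (1 + \<bar>s\<bar>) * (cmod (f t) / (1 + \<bar>t\<bar>)))"
    using assms
    by (intro integral_mono Psi_integrand_bound integrable_norm integrable_Psi_integrand integrable_mult_right)
      (simp_all add: weighted_L1_def)
  finally show ?thesis by (simp only: integral_mult_right_zero)
qed

lemma Psi_add:
  assumes "weighted_L1 f" "weighted_L1 g"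
  shows "Psi (\<lambda>t. f t + g t) = (\<lambda>s. Psi f s + Psi g s)"
proof
  fix s
  have "Psi_integrand (\<lambda>t. f t + g t) s = (\<lambda>t. Psi_integrand f s t + Psi_integrand g s t)"
    by (simp add: Psi_integrand_kernel distrib_left fun_eq_iff)
  then show "Psi (\<lambda>t. f t + g t) s = Psi f s + Psi g s"
    unfolding Psi_eq_integral
    by (simp add: Bochner_Integration.integral_add integrable_Psi_integrand assms)
qed

lemma Psi_scale: "Psi (\<lambda>t. a * f t) = (\<lambda>s. a * Psi f s)"
proof
  fix s
  have "Psi_integrand (\<lambda>t. a * f t) s = (\<lambda>t. a * Psi_integrand f s t)"
    by (simp add: Psi_integrand_kernel fun_eq_iff)
  then show "Psi (\<lambda>t. a * f t) s = a * Psi f s"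
    unfolding Psi_eq_integral by simp
qed

lemma Psi_cong_AE:
  assumes [measurable]: "f \<in> borel_measurable lebesgue" "g \<in> borel_measurable lebesgue"
    and eq: "AE t in lebesgue. f t = g t"
  shows "Psi f = Psi g"
proof
  fix s
  show "Psi f s = Psi g s"
    unfolding Psi_eq_integral Psi_integrand_kernel
    by (rule integral_cong_AE) (use eq in \<open>auto elim!: eventually_mono\<close>)
qed

text \<open>Fubini's theorem is applied on the product of two copies of the Borel-Lebesgue measure, for
  which a Lebesgue measurable function must first be replaced by a Borel function.\<close>

lemma lebesgue_measurable_ex_borel:
  fixes f :: "real \<Rightarrow> complex"
  assumes f [measurable]: "f \<in> borel_measurable lebesgue"
  obtains g where "g \<in> borel_measurable borel" "AE x in lborel. f x = g x"
proof -
  obtain a where a: "a \<in> borel_measurable lborel" "AE x in lborel. Re (f x) = a x"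
    using completion_ex_borel_measurable_real[of "\<lambda>x. Re (f x)" lborel] by auto
  obtain b where b: "b \<in> borel_measurable lborel" "AE x in lborel. Im (f x) = b x"
    using completion_ex_borel_measurable_real[of "\<lambda>x. Im (f x)" lborel] by auto
  show ?thesis
  proof (rule that[of "\<lambda>x. Complex (a x) (b x)"])
    show "(\<lambda>x. Complex (a x) (b x)) \<in> borel_measurable borel"
      using a b by (simp add: Complex_eq)
    show "AE x in lborel. f x = Complex (a x) (b x)"
      using a(2) b(2) by eventually_elim (simp add: complex_eq_iff)
  qed
qed

section \<open>The derivative of the integrated transform is the Fourier transform\<close>

lemma Psi_integrand_borel_pair [measurable]:
  fixes g :: "real \<Rightarrow> complex"
  assumes [measurable]: "g \<in> borel_measurable borel"
  shows "case_prod (Psi_integrand g) \<in> borel_measurable (borel \<Otimes>\<^sub>M borel)"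
proof -
  have "case_prod (Psi_integrand g) = (\<lambda>x. Psi_kernel (fst x) (snd x) * g (snd x))"
    by (auto simp: Psi_integrand_kernel)
  then show ?thesis by simp
qed

lemma Psi_integrand_borel:
  assumes [measurable]: "g \<in> borel_measurable borel"
  shows "Psi_integrand g s \<in> borel_measurable borel"
  unfolding Psi_integrand_def[abs_def] by measurable

lemma Psi_borel:
  assumes f: "f \<in> borel_measurable lebesgue"
  shows "Psi f \<in> borel_measurable borel"
proof -
  obtain g where g [measurable]: "g \<in> borel_measurable borel" and eq: "AE x in lborel. f x = g x"
    using lebesgue_measurable_ex_borel[OF f] .
  have gl: "g \<in> borel_measurable lebesgue" using g by (intro measurable_completion) simp
  have "Psi f = Psi g"
    using eq by (intro Psi_cong_AE f gl) (rule AE_completion)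
  also have "Psi g = (\<lambda>s. LINT t|lborel. Psi_integrand g s t)"
  proof
    fix s
    have "Psi_integrand g s \<in> borel_measurable lborel" by (simp add: Psi_integrand_borel)
    then show "Psi g s = (LINT t|lborel. Psi_integrand g s t)"
      unfolding Psi_eq_integral by (rule integral_completion)
  qed
  also have "\<dots> \<in> borel_measurable borel"
    by (rule sigma_finite_measure.borel_measurable_lebesgue_integral[OF sigma_finite_lborel]) simp
  finally show ?thesis .
qed

text \<open>The linear growth of \<open>Psi f\<close> is absorbed by the decay of the Schwartz function. The second part
  gives continuity of the functional.\<close>

lemma integrable_Psi_times_schwartz:
  assumes f: "weighted_L1 f" and \<phi>: "\<phi> \<in> schwartz_functions"
  shows "integrable lborel (\<lambda>s. Psi f s * nth_deriv k \<phi> s)"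
    and "cmod (LINT s|lborel. Psi f s * nth_deriv k \<phi> s)
      \<le> 2 * (LINT t|lebesgue. cmod (f t) / (1 + \<bar>t\<bar>)) * (LINT s|lborel. (1 + \<bar>s\<bar>) * cmod (nth_deriv k \<phi> s))"
proof -
  let ?W = "LINT t|lebesgue. cmod (f t) / (1 + \<bar>t\<bar>)"
  have W: "0 \<le> ?W" by simp
  have bound: "cmod (Psi f s * nth_deriv k \<phi> s) \<le> 2 * ?W * ((1 + \<bar>s\<bar>) * cmod (nth_deriv k \<phi> s))" for s
    using mult_right_mono[OF Psi_bound[OF f, of s], of "cmod (nth_deriv k \<phi> s)"]
    by (simp only: norm_mult norm_ge_zero mult.assoc mult.left_commute mult.commute)
  note int = integrable_mult_right[OF schwartz_integrable_weighted[OF \<phi>, of k], of "2 * ?W"]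
  have Pm: "Psi f \<in> borel_measurable borel" using f by (intro Psi_borel) (simp add: weighted_L1_def)
  have meas: "(\<lambda>s. Psi f s * nth_deriv k \<phi> s) \<in> borel_measurable lborel"
    using Pm schwartz_borel[OF \<phi>] by simp
  show 1: "integrable lborel (\<lambda>s. Psi f s * nth_deriv k \<phi> s)"
  proof (rule Bochner_Integration.integrable_bound[OF int meas], intro always_eventually allI)
    fix s show "norm (Psi f s * nth_deriv k \<phi> s) \<le> norm (2 * ?W * ((1 + \<bar>s\<bar>) * cmod (nth_deriv k \<phi> s)))"
      by (rule order_trans[OF bound]) (simp only: real_norm_def abs_ge_self)
  qed
  have "cmod (LINT s|lborel. Psi f s * nth_deriv k \<phi> s) \<le> (LINT s|lborel. cmod (Psi f s * nth_deriv k \<phi> s))"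
    by (rule integral_norm_bound)
  also have "\<dots> \<le> (LINT s|lborel. 2 * ?W * ((1 + \<bar>s\<bar>) * cmod (nth_deriv k \<phi> s)))"
    by (intro integral_mono integrable_norm 1 int bound)
  finally show "cmod (LINT s|lborel. Psi f s * nth_deriv k \<phi> s)
      \<le> 2 * ?W * (LINT s|lborel. (1 + \<bar>s\<bar>) * cmod (nth_deriv k \<phi> s))"
    by (simp only: integral_mult_right_zero)
qed

lemma schwartz_weighted_integral_le:
  "\<exists>C\<ge>0. \<forall>\<phi>\<in>schwartz_functions. (LINT s|lborel. (1 + \<bar>s\<bar>) * cmod (nth_deriv k \<phi> s))
     \<le> C * (\<Sum>j\<le>3. schwartz_seminorm j k \<phi>)"
proof (intro exI conjI ballI)
  fix \<phi> assume \<phi>: "\<phi> \<in> schwartz_functions"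
  have int: "integrable lborel (\<lambda>s::real. (1 + \<bar>s\<bar>) powr (-2))"
    using integrable_inverse_weight_powr[of 2] by simp
  have "(LINT s|lborel. (1 + \<bar>s\<bar>) * cmod (nth_deriv k \<phi> s))
      \<le> (LINT s|lborel. 3 * (\<Sum>j\<le>3. schwartz_seminorm j k \<phi>) * (1 + \<bar>s\<bar>) powr (-2))"
    by (intro integral_mono schwartz_integrable_weighted \<phi> integrable_mult_right int schwartz_decay)
  also have "\<dots> = 3 * (\<Sum>j\<le>3. schwartz_seminorm j k \<phi>) * (LINT s|lborel. (1 + \<bar>s\<bar>) powr (-2))"
    by (rule integral_mult_right_zero)
  finally show "(LINT s|lborel. (1 + \<bar>s\<bar>) * cmod (nth_deriv k \<phi> s))
     \<le> 3 * (LINT s|lborel. (1 + \<bar>s\<bar>) powr (-2)) * (\<Sum>j\<le>3. schwartz_seminorm j k \<phi>)"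
    by (simp only: mult.assoc mult.left_commute mult.commute)
qed simp

lemma distributional_derivative_Psi_eq:
  assumes f: "weighted_L1 f" and \<phi>: "\<phi> \<in> schwartz_functions"
  shows "distributional_derivative (Psi f) \<phi> = - (LINT s|lborel. Psi f s * nth_deriv 1 \<phi> s)"
    and "integrable lebesgue (\<lambda>s. Psi f s * vector_derivative \<phi> (at s))"
proof -
  have eq: "(\<lambda>s. Psi f s * vector_derivative \<phi> (at s)) = (\<lambda>s. Psi f s * nth_deriv 1 \<phi> s)"
    by (simp add: nth_deriv_Suc)
  note int = integrable_Psi_times_schwartz(1)[OF f \<phi>, of 1]
  then have "(\<lambda>s. Psi f s * nth_deriv 1 \<phi> s) \<in> borel_measurable lborel" by (rule borel_measurable_integrable)
  then show "distributional_derivative (Psi f) \<phi> = - (LINT s|lborel. Psi f s * nth_deriv 1 \<phi> s)"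
      "integrable lebesgue (\<lambda>s. Psi f s * vector_derivative \<phi> (at s))"
    unfolding distributional_derivative_def eq using \<phi> int
    by (simp_all add: integral_completion integrable_completion)
qed

lemma Psi_kernel_has_vector_derivative:
  "t \<noteq> 0 \<Longrightarrow> ((\<lambda>s. Psi_kernel s t) has_vector_derivative exp (- (\<i> * of_real s * of_real t))) (at s)"
proof -
  assume t: "t \<noteq> 0"
  have "((\<lambda>z. (1 - exp (- (\<i> * z * of_real t))) / (\<i> * of_real t)) has_field_derivative
      exp (- (\<i> * of_real s * of_real t))) (at (of_real s))"
    using t by (auto intro!: derivative_eq_intros)
  from has_vector_derivative_real_field[OF this] show ?thesis
    by (simp add: Psi_kernel_def)
qed

text \<open>The derivative of the kernel with respect to \<open>s\<close> is \<open>exp(-ist)\<close>, and for fixed \<open>t \<noteq> 0\<close> the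
  kernel is bounded by \<open>2/|t|\<close>, so the boundary terms vanish.\<close>

lemma Psi_kernel_parts:
  assumes \<phi>: "\<phi> \<in> schwartz_functions" and t: "t \<noteq> 0"
  shows "(LINT s|lborel. Psi_kernel s t * nth_deriv 1 \<phi> s)
    = - (LINT s|lborel. exp (- (\<i> * of_real s * of_real t)) * \<phi> s)"
proof -
  let ?e = "\<lambda>s. exp (- (\<i> * of_real s * of_real t))"
  let ?F = "\<lambda>s. Psi_kernel s t * \<phi> s"
  have Kb: "cmod (Psi_kernel s t) \<le> 2 / \<bar>t\<bar>" for s
    using norm_triangle_ineq4[of 1 "?e s"] norm_unit_exp[of s t] t
    by (simp add: Psi_kernel_def norm_divide norm_mult divide_right_mono)
  have Km [measurable]: "(\<lambda>s. Psi_kernel s t) \<in> borel_measurable borel"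
    unfolding Psi_kernel_def by measurable
  have D: "(?F has_vector_derivative (?e s * \<phi> s + Psi_kernel s t * nth_deriv 1 \<phi> s)) (at s)" for s
    using has_vector_derivative_mult[OF Psi_kernel_has_vector_derivative[OF t] schwartz_has_vector_derivative[OF \<phi>, of 0 s]]
    by (simp add: add.commute)
  have i1: "integrable lborel (\<lambda>s. ?e s * \<phi> s)"
    using schwartz_integrable[OF \<phi>, of 0] schwartz_borel[OF \<phi>, of 0]
    by (intro Bochner_Integration.integrable_bound[OF schwartz_integrable[OF \<phi>, of 0]])
      (auto simp: norm_mult)
  have i2: "integrable lborel (\<lambda>s. Psi_kernel s t * nth_deriv 1 \<phi> s)"
  proof (rule Bochner_Integration.integrable_bound)
    show "integrable lborel (\<lambda>s. 2 / \<bar>t\<bar> * cmod (nth_deriv 1 \<phi> s))"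
      by (intro integrable_mult_right integrable_norm schwartz_integrable \<phi>)
    show "(\<lambda>s. Psi_kernel s t * nth_deriv 1 \<phi> s) \<in> borel_measurable lborel"
      using schwartz_borel[OF \<phi>, of 1] by simp
    show "AE s in lborel. norm (Psi_kernel s t * nth_deriv 1 \<phi> s) \<le> norm (2 / \<bar>t\<bar> * cmod (nth_deriv 1 \<phi> s))"
      using mult_right_mono[OF Kb norm_ge_zero] by (intro always_eventually allI) (simp add: norm_mult)
  qed
  have lim: "(?F \<longlongrightarrow> 0) at_infinity"
  proof (rule Lim_null_comparison)
    show "\<forall>\<^sub>F s in at_infinity. norm (?F s) \<le> 2 / \<bar>t\<bar> * norm (\<phi> s)"
      using mult_right_mono[OF Kb norm_ge_zero] by (intro always_eventually allI) (simp add: norm_mult)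
    show "((\<lambda>s. 2 / \<bar>t\<bar> * norm (\<phi> s)) \<longlongrightarrow> 0) at_infinity"
      using tendsto_mult_left[OF tendsto_norm[OF schwartz_tendsto_0[OF \<phi>]], of "2 / \<bar>t\<bar>"] by simp
  qed
  have "(LBINT s=-\<infinity>..\<infinity>. ?e s * \<phi> s + Psi_kernel s t * nth_deriv 1 \<phi> s) = 0 - 0"
  proof (rule interval_integral_FTC_integrable[where F = ?F])
    show "isCont (\<lambda>s. ?e s * \<phi> s + Psi_kernel s t * nth_deriv 1 \<phi> s) x" for x
      using schwartz_continuous[OF \<phi>, where k = 0 and x = x] schwartz_continuous[OF \<phi>, where k = 1 and x = x]
        has_vector_derivative_continuous[OF Psi_kernel_has_vector_derivative[OF t]]
      by (intro continuous_intros) auto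
    show "set_integrable lborel (einterval (-\<infinity>) \<infinity>) (\<lambda>s. ?e s * \<phi> s + Psi_kernel s t * nth_deriv 1 \<phi> s)"
      using i1 i2 by (simp add: set_integrable_def)
    have "(?F \<longlongrightarrow> 0) at_top" "(?F \<longlongrightarrow> 0) at_bot"
      using lim at_top_le_at_infinity at_bot_le_at_infinity tendsto_mono by blast+
    then show "((?F \<circ> real_of_ereal) \<longlongrightarrow> 0) (at_right (-\<infinity>))" "((?F \<circ> real_of_ereal) \<longlongrightarrow> 0) (at_left \<infinity>)"
      by (simp_all add: ereal_tendsto_simps)
  qed (use D in auto)
  then have "(LINT s|lborel. ?e s * \<phi> s + Psi_kernel s t * nth_deriv 1 \<phi> s) = 0"
    by (simp add: interval_lebesgue_integral_def set_lebesgue_integral_def)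
  then show ?thesis
    using i1 i2 by (simp add: Bochner_Integration.integral_add add_eq_0_iff)
qed

text \<open>The identity that justifies viewing \<open>Psi f\<close> as an integrated Fourier transform.\<close>

lemma distributional_derivative_Psi_fourier:
  assumes g [measurable]: "g \<in> borel_measurable borel" and w: "weighted_L1 g" and \<phi>: "\<phi> \<in> schwartz_functions"
  shows "distributional_derivative (Psi g) \<phi>
    = (LINT t|lborel. (LINT s|lborel. exp (- (\<i> * of_real s * of_real t)) * \<phi> s) * g t)"
proof -
  let ?H = "\<lambda>s t. Psi_integrand g s t * nth_deriv 1 \<phi> s"
  note [measurable] = schwartz_borel[OF \<phi>, of 1]
  have wi: "integrable lborel (\<lambda>t. cmod (g t) / (1 + \<bar>t\<bar>))"
    using w by (simp add: weighted_L1_def integrable_completion)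
  have pm [measurable]: "case_prod ?H \<in> borel_measurable (lborel \<Otimes>\<^sub>M lborel)"
  proof -
    have "case_prod ?H = (\<lambda>x. case_prod (Psi_integrand g) x * nth_deriv 1 \<phi> (fst x))" by auto
    then have "case_prod ?H \<in> borel_measurable (borel \<Otimes>\<^sub>M borel)"
      by (simp only:) (intro borel_measurable_times Psi_integrand_borel_pair g
        measurable_compose[OF measurable_fst schwartz_borel[OF \<phi>]])
    then show ?thesis
      by (simp add: measurable_cong_sets[OF sets_pair_measure_cong[OF sets_lborel sets_lborel] refl])
  qed
  have int: "integrable (lborel \<Otimes>\<^sub>M lborel) (case_prod ?H)"
  proof (rule Bochner_Integration.integrable_bound[OF _ pm])
    let ?B = "\<lambda>s t. (2 * ((1 + \<bar>s\<bar>) * cmod (nth_deriv 1 \<phi> s))) * (cmod (g t) / (1 + \<bar>t\<bar>))"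
    show "integrable (lborel \<Otimes>\<^sub>M lborel) (case_prod ?B)"
    proof (rule lborel_pair.Fubini_integrable)
      have "(LINT t|lborel. norm (case (s, t) of (s, t) \<Rightarrow> ?B s t))
          = (2 * ((1 + \<bar>s\<bar>) * cmod (nth_deriv 1 \<phi> s))) * (LINT t|lborel. cmod (g t) / (1 + \<bar>t\<bar>))" for s
        by (subst integral_mult_right_zero[symmetric]) (simp add: abs_mult)
      then show "integrable lborel (\<lambda>s. LINT t|lborel. norm (case (s, t) of (s, t) \<Rightarrow> ?B s t))"
        using schwartz_integrable_weighted[OF \<phi>, of 1]
        by (simp only:) (intro integrable_mult_left integrable_mult_right)
      show "AE s in lborel. integrable lborel (\<lambda>t. case (s, t) of (s, t) \<Rightarrow> ?B s t)"
        using wi by (intro always_eventually allI) (simp only: split integrable_mult_right)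
    qed measurable
    show "AE x in lborel \<Otimes>\<^sub>M lborel. norm (case_prod ?H x) \<le> norm (case_prod ?B x)"
    proof (intro always_eventually allI, clarify)
      fix s t
      have "norm (?H s t) \<le> 2 * (1 + \<bar>s\<bar>) * (cmod (g t) / (1 + \<bar>t\<bar>)) * cmod (nth_deriv 1 \<phi> s)"
        by (simp only: norm_mult) (rule mult_right_mono[OF Psi_integrand_bound norm_ge_zero])
      also have "\<dots> = ?B s t" by simp
      also have "\<dots> \<le> norm (?B s t)" by (simp only: real_norm_def abs_ge_self)
      finally show "norm (?H s t) \<le> norm (?B s t)" .
    qed
  qed
  have "(LINT s|lborel. Psi g s * nth_deriv 1 \<phi> s) = (LINT s|lborel. (LINT t|lborel. ?H s t))"
  proof (intro Bochner_Integration.integral_cong refl)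
    fix s
    have "Psi_integrand g s \<in> borel_measurable lborel" by (simp add: Psi_integrand_borel)
    then have "Psi g s = (LINT t|lborel. Psi_integrand g s t)"
      unfolding Psi_eq_integral by (rule integral_completion)
    then show "Psi g s * nth_deriv 1 \<phi> s = (LINT t|lborel. ?H s t)" by simp
  qed
  also have "\<dots> = (LINT t|lborel. (LINT s|lborel. ?H s t))"
    using lborel_pair.Fubini_integral[OF int] by simp
  also have "\<dots> = (LINT t|lborel. - ((LINT s|lborel. exp (- (\<i> * of_real s * of_real t)) * \<phi> s) * g t))"
  proof (rule Bochner_Integration.integral_cong_AE)
    show "AE t in lborel. (LINT s|lborel. ?H s t)
        = - ((LINT s|lborel. exp (- (\<i> * of_real s * of_real t)) * \<phi> s) * g t)"
      \<comment> \<open>At \<open>t = 0\<close> the kernel is 0 by convention and the identity may fail; a single point is null.\<close>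
      using AE_lborel_singleton[of 0]
    proof eventually_elim
      case (elim t)
      have "(LINT s|lborel. ?H s t) = (LINT s|lborel. (Psi_kernel s t * nth_deriv 1 \<phi> s) * g t)"
        by (simp add: Psi_integrand_kernel ac_simps)
      then show ?case using Psi_kernel_parts[OF \<phi> elim] by simp
    qed
    show "(\<lambda>t. LINT s|lborel. ?H s t) \<in> borel_measurable lborel"
      using lborel_pair.integrable_snd[OF int] by (rule borel_measurable_integrable)
    note [measurable] = schwartz_borel[OF \<phi>, of 0, simplified]
    show "(\<lambda>t. - ((LINT s|lborel. exp (- (\<i> * of_real s * of_real t)) * \<phi> s) * g t)) \<in> borel_measurable lborel"
      by measurable
  qed
  finally show ?thesis
    by (simp add: distributional_derivative_Psi_eq(1)[OF w \<phi>])
qed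

lemma weighted_L1_cong_AE:
  assumes f: "weighted_L1 f" and g: "g \<in> borel_measurable lebesgue" and eq: "AE x in lebesgue. f x = g x"
  shows "weighted_L1 g"
proof -
  note [measurable] = g ident_measurable_lebesgue
  have "integrable lebesgue (\<lambda>t. cmod (g t) / (1 + \<bar>t\<bar>))"
    using f eq unfolding weighted_L1_def
    by (subst integrable_cong_AE[where g = "\<lambda>t. cmod (f t) / (1 + \<bar>t\<bar>)"]) (auto elim!: eventually_mono)
  with g show ?thesis by (simp add: weighted_L1_def)
qed

text \<open>Evaluation at all translated Gaussians shows that \<open>f(t) exp(-t\<^sup>2/2)\<close>, an integrable function
  since the Gaussian beats the weight, has vanishing Fourier transform.\<close>

lemma distributional_derivative_Psi_zero_imp_AE_zero:
  assumes f: "weighted_L1 f" and zero: "\<And>\<phi>. \<phi> \<in> schwartz_functions \<Longrightarrow> distributional_derivative (Psi f) \<phi> = 0"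
  shows "AE x in lebesgue. f x = 0"
proof -
  have fm: "f \<in> borel_measurable lebesgue" using f by (simp add: weighted_L1_def)
  obtain g where g [measurable]: "g \<in> borel_measurable borel" and eq: "AE x in lborel. f x = g x"
    using lebesgue_measurable_ex_borel[OF fm] .
  have gl: "g \<in> borel_measurable lebesgue" using g by (intro measurable_completion) simp
  have eql: "AE x in lebesgue. f x = g x" using eq by (rule AE_completion)
  have wg: "weighted_L1 g" using weighted_L1_cong_AE[OF f gl eql] .
  have PP: "Psi f = Psi g" by (rule Psi_cong_AE[OF fm gl eql])
  let ?G = "\<lambda>t. of_real (exp (- t\<^sup>2 / 2)) * g t"
  have "AE t in lborel. ?G t = 0"
  proof (rule fourier_transform_zero_imp_AE_zero)
    have wi: "integrable lborel (\<lambda>t. exp (1/2) * (cmod (g t) / (1 + \<bar>t\<bar>)))"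
      using wg by (intro integrable_mult_right) (simp add: weighted_L1_def integrable_completion)
    show "integrable lborel ?G"
    proof (rule Bochner_Integration.integrable_bound[OF wi])
      have "norm (?G t) \<le> norm (exp (1/2) * (cmod (g t) / (1 + \<bar>t\<bar>)))" for t
      proof -
        have "exp (- t\<^sup>2 / 2) * (1 + \<bar>t\<bar>) \<le> exp (- t\<^sup>2 / 2) * exp \<bar>t\<bar>"
          by (intro mult_left_mono exp_ge_add_one_self) auto
        also have "\<dots> = exp (\<bar>t\<bar> - t\<^sup>2 / 2)" by (simp add: exp_add[symmetric])
        also have "\<bar>t\<bar> - t\<^sup>2 / 2 \<le> 1/2"
          using zero_le_power2[of "\<bar>t\<bar> - 1"] by (simp add: power2_diff)
        finally have "exp (- t\<^sup>2 / 2) \<le> exp (1/2) / (1 + \<bar>t\<bar>)" by (simp add: field_simps)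
        from mult_right_mono[OF this, of "cmod (g t)"] show ?thesis by (simp add: norm_mult)
      qed
      then show "AE t in lborel. norm (?G t) \<le> norm (exp (1/2) * (cmod (g t) / (1 + \<bar>t\<bar>)))" by simp
    qed measurable
    fix \<xi>
    have "0 = distributional_derivative (Psi g) (gaussian \<xi>)"
      using zero[OF gaussian_schwartz] PP by simp
    also have "\<dots> = (LINT t|lborel. of_real (sqrt (2 * pi)) * (iexp (\<xi> * t) * ?G t))"
      unfolding distributional_derivative_Psi_fourier[OF g wg gaussian_schwartz] fourier_gaussian
      by (simp only: mult.assoc)
    also have "\<dots> = of_real (sqrt (2 * pi)) * (LINT t|lborel. iexp (\<xi> * t) * ?G t)"
      by (rule integral_mult_right_zero)
    finally show "(LINT t|lborel. iexp (\<xi> * t) * ?G t) = 0" by simp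
  qed
  then have "AE t in lborel. f t = 0" using eq by eventually_elim simp
  then show ?thesis by (rule AE_completion)
qed

section \<open>Spaces represented by faithful linear images\<close>

text \<open>A linear map on the functions in the variable Lebesgue space whose kernel is exactly the set of
  null functions; it therefore factors injectively through the classes. Both \<open>Psi\<close> and the
  distributional derivative of \<open>Psi\<close> are of this kind, with points \<open>'x\<close> that are reals in the first
  case and test functions in the second.\<close>

locale faithful_representation = admissible_exponent p
  for p :: "real \<Rightarrow> ennreal" +
  fixes \<Phi> :: "(real \<Rightarrow> complex) \<Rightarrow> 'x \<Rightarrow> complex"
  assumes rep_add: "\<lbrakk>f \<in> Lp_functions p; g \<in> Lp_functions p\<rbrakk>
      \<Longrightarrow> \<Phi> (\<lambda>t. f t + g t) = (\<lambda>x. \<Phi> f x + \<Phi> g x)"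
    and rep_scale: "f \<in> Lp_functions p \<Longrightarrow> \<Phi> (\<lambda>t. a * f t) = (\<lambda>x. a * \<Phi> f x)"
    and rep_eq_zero_iff: "f \<in> Lp_functions p \<Longrightarrow> \<Phi> f = (\<lambda>x. 0) \<longleftrightarrow> (AE t in lebesgue. f t = 0)"
begin

definition image_norm :: "('x \<Rightarrow> complex) \<Rightarrow> real" where
  "image_norm F = (THE r. \<exists>f\<in>Lp_functions p. F = \<Phi> f \<and> r = Lp_norm p f)"

abbreviation image_space :: "('x \<Rightarrow> complex) normed_structure" where
  "image_space \<equiv> pointwise_space (\<Phi> ` Lp_functions p) image_norm"

lemma rep_diff:
  assumes "f \<in> Lp_functions p" "g \<in> Lp_functions p"
  shows "\<Phi> (\<lambda>t. f t - g t) = (\<lambda>x. \<Phi> f x - \<Phi> g x)"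
  using rep_add[OF assms(1) Lp_functions_scale[OF assms(2), of "-1"]] rep_scale[OF assms(2), of "-1"]
  by simp

lemma rep_eq_iff:
  assumes "f \<in> Lp_functions p" "g \<in> Lp_functions p"
  shows "\<Phi> f = \<Phi> g \<longleftrightarrow> (AE t in lebesgue. f t = g t)"
proof -
  have "\<Phi> f = \<Phi> g \<longleftrightarrow> \<Phi> (\<lambda>t. f t - g t) = (\<lambda>x. 0)"
    by (simp add: rep_diff[OF assms] fun_eq_iff)
  also have "\<dots> \<longleftrightarrow> (AE t in lebesgue. f t = g t)"
    using rep_eq_zero_iff[OF Lp_functions_diff[OF assms]] by simp
  finally show ?thesis .
qed

text \<open>Functions with the same image agree almost everywhere and so have the same norm, which makes
  the definite description well defined.\<close>

lemma image_norm_rep: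
  assumes f: "f \<in> Lp_functions p"
  shows "image_norm (\<Phi> f) = Lp_norm p f"
  unfolding image_norm_def
proof (rule the_equality)
  show "\<exists>g\<in>Lp_functions p. \<Phi> f = \<Phi> g \<and> Lp_norm p f = Lp_norm p g"
    using f by (intro bexI[of _ f]) simp_all
  fix r assume "\<exists>g\<in>Lp_functions p. \<Phi> f = \<Phi> g \<and> r = Lp_norm p g"
  then obtain g where g: "g \<in> Lp_functions p" "\<Phi> f = \<Phi> g" "r = Lp_norm p g" by blast
  then show "r = Lp_norm p f"
    using Lp_norm_cong_AE[OF f g(1)] rep_eq_iff[OF f g(1)] by (simp only:)
qed

lemma image_space_simps [simp]:
  "vcarrier image_space = \<Phi> ` Lp_functions p"
  "vadd image_space F G = (\<lambda>x. F x + G x)"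
  "vzero image_space = (\<lambda>x. 0)"
  "vscale image_space a F = (\<lambda>x. a * F x)"
  "vnorm image_space = image_norm"
  by (simp_all add: pointwise_space_def)

lemma rep_zero: "\<Phi> (\<lambda>t. 0) = (\<lambda>x. 0)"
  using rep_eq_zero_iff[OF zero_in_Lp_functions] by simp

lemma image_space_banach: "complex_banach_space_on image_space"
proof
  fix F G assume "F \<in> vcarrier image_space" "G \<in> vcarrier image_space"
  then obtain f g where fg: "f \<in> Lp_functions p" "g \<in> Lp_functions p" "F = \<Phi> f" "G = \<Phi> g" by auto
  then have add: "vadd image_space F G = \<Phi> (\<lambda>t. f t + g t)" by (simp add: rep_add)
  then show "vadd image_space F G \<in> vcarrier image_space"
    using Lp_functions_add[OF fg(1,2)] by simp
  show "vnorm image_space (vadd image_space F G) \<le> vnorm image_space F + vnorm image_space G"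
    unfolding add using fg Lp_norm_triangle[OF fg(1,2)]
    by (simp add: image_norm_rep Lp_functions_add)
next
  show "vzero image_space \<in> vcarrier image_space"
    using zero_in_Lp_functions rep_zero by force
next
  fix F a assume "F \<in> vcarrier image_space"
  then obtain f where f: "f \<in> Lp_functions p" "F = \<Phi> f" by auto
  then have sc: "vscale image_space b F = \<Phi> (\<lambda>t. b * f t)" for b by (simp add: rep_scale)
  then show "vscale image_space a F \<in> vcarrier image_space"
    using Lp_functions_scale[OF f(1)] by simp
  show "vnorm image_space (vscale image_space a F) = cmod a * vnorm image_space F"
    unfolding sc using f by (simp add: image_norm_rep Lp_functions_scale Lp_norm_scale)
  show "0 \<le> vnorm image_space F" using f by (simp add: image_norm_rep Lp_norm_nonneg)
  show "(vnorm image_space F = 0) = (F = vzero image_space)"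
    using f by (simp add: image_norm_rep Lp_norm_eq_0_iff rep_eq_zero_iff)
  show "\<exists>G\<in>vcarrier image_space. vadd image_space F G = vzero image_space"
  proof (rule bexI)
    show "vscale image_space (-1) F \<in> vcarrier image_space"
      unfolding sc using Lp_functions_scale[OF f(1), of "-1"] by simp
  qed simp
next
  fix u :: "nat \<Rightarrow> 'x \<Rightarrow> complex"
  assume u: "\<And>n. u n \<in> vcarrier image_space"
    and cauchy: "\<And>e. 0 < e \<Longrightarrow> \<exists>N. \<forall>m\<ge>N. \<forall>n\<ge>N. vnorm image_space (vdiff image_space (u m) (u n)) < e"
  from u have "\<forall>n. \<exists>f. f \<in> Lp_functions p \<and> u n = \<Phi> f" by auto
  then obtain f where f: "\<And>n. f n \<in> Lp_functions p" "\<And>n. u n = \<Phi> (f n)" by metis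
  have diff: "vnorm image_space (vdiff image_space (\<Phi> g) (\<Phi> h)) = Lp_norm p (\<lambda>t. g t - h t)"
    if "g \<in> Lp_functions p" "h \<in> Lp_functions p" for g h
    using that by (simp add: vdiff_def image_norm_rep Lp_functions_diff flip: rep_diff)
  have ev: "\<And>e. 0 < e \<Longrightarrow> \<exists>N. \<forall>m\<ge>N. \<forall>n\<ge>N. Lp_norm p (\<lambda>t. f m t - f n t) < e"
    using cauchy unfolding f(2) diff[OF f(1) f(1)] .
  from Lp_complete[OF f(1) ev]
  obtain g where g: "g \<in> Lp_functions p" "(\<lambda>n. Lp_norm p (\<lambda>t. f n t - g t)) \<longlonglongrightarrow> 0"
    by blast
  show "\<exists>x\<in>vcarrier image_space. (\<lambda>n. vnorm image_space (vdiff image_space (u n) x)) \<longlonglongrightarrow> 0"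
  proof (rule bexI)
    show "(\<lambda>n. vnorm image_space (vdiff image_space (u n) (\<Phi> g))) \<longlonglongrightarrow> 0"
      unfolding f(2) diff[OF f(1) g(1)] by (rule g(2))
  qed (use g in simp)
next
  fix F G H :: "'x \<Rightarrow> complex" and a b :: complex
  show "vadd image_space (vadd image_space F G) H = vadd image_space F (vadd image_space G H)"
    "vadd image_space F G = vadd image_space G F"
    "vadd image_space F (vzero image_space) = F"
    "vscale image_space a (vadd image_space F G) = vadd image_space (vscale image_space a F) (vscale image_space a G)"
    "vscale image_space (a + b) F = vadd image_space (vscale image_space a F) (vscale image_space b F)"
    "vscale image_space a (vscale image_space b F) = vscale image_space (a * b) F"
    "vscale image_space 1 F = F"
    by (simp_all add: fun_eq_iff algebra_simps)
qed

text \<open>The equivalence class of a function, described through the map: by faithfulness it is a fibre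
  of \<open>\<Phi>\<close>.\<close>

definition Lp_class :: "(real \<Rightarrow> complex) \<Rightarrow> (real \<Rightarrow> complex) set" where
  "Lp_class f = {g \<in> Lp_functions p. \<Phi> g = \<Phi> f}"

lemma Lp_rel_class:
  assumes "f \<in> Lp_functions p"
  shows "Lp_rel p `` {f} = Lp_class f"
  using assms by (auto simp: Lp_rel_def Lp_class_def rep_eq_iff[OF assms, symmetric])

text \<open>The unions in the operations on classes run over sets that all coincide, because the class of
  the result does not depend on the representatives.\<close>

lemma Lp_space_class:
  assumes f: "f \<in> Lp_functions p" and g: "g \<in> Lp_functions p"
  shows "vadd (Lp_space p) (Lp_class f) (Lp_class g) = Lp_class (\<lambda>t. f t + g t)"
    and "vscale (Lp_space p) a (Lp_class f) = Lp_class (\<lambda>t. a * f t)"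
    and "vnorm (Lp_space p) (Lp_class f) = Lp_norm p f"
proof -
  have self: "f \<in> Lp_class f" "g \<in> Lp_class g" using f g by (auto simp: Lp_class_def)
  have add: "Lp_rel p `` {\<lambda>t. f' t + g' t} = Lp_class (\<lambda>t. f t + g t)"
    if "f' \<in> Lp_class f" "g' \<in> Lp_class g" for f' g'
    using that f g by (subst Lp_rel_class) (auto simp: Lp_class_def Lp_functions_add rep_add)
  show "vadd (Lp_space p) (Lp_class f) (Lp_class g) = Lp_class (\<lambda>t. f t + g t)"
    using self by (auto simp: Lp_space_def add cong: SUP_cong)
  have scale: "Lp_rel p `` {\<lambda>t. a * f' t} = Lp_class (\<lambda>t. a * f t)" if "f' \<in> Lp_class f" for f'
    using that f by (subst Lp_rel_class) (auto simp: Lp_class_def Lp_functions_scale rep_scale)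
  show "vscale (Lp_space p) a (Lp_class f) = Lp_class (\<lambda>t. a * f t)"
    using self by (auto simp: Lp_space_def scale cong: SUP_cong)
  have "Lp_norm p g' = Lp_norm p f" if "g' \<in> Lp_class f" for g'
    using that f Lp_norm_cong_AE[of g' f] rep_eq_iff[of g' f] by (simp add: Lp_class_def)
  then have "Lp_norm p ` Lp_class f = {Lp_norm p f}" using self(1) by blast
  then show "vnorm (Lp_space p) (Lp_class f) = Lp_norm p f" by (simp add: Lp_space_def)
qed

text \<open>The isomorphism sends a point of the range to its fibre.\<close>

lemma image_space_isometric: "isometrically_isomorphic image_space (Lp_space p)"
proof -
  define T where "T F = {f \<in> Lp_functions p. \<Phi> f = F}" for F
  have T: "T (\<Phi> f) = Lp_class f" for f by (simp add: T_def Lp_class_def)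
  have bij: "bij_betw T (vcarrier image_space) (vcarrier (Lp_space p))"
    unfolding bij_betw_def
  proof
    show "inj_on T (vcarrier image_space)" by (auto simp: inj_on_def T_def)
    show "T ` vcarrier image_space = vcarrier (Lp_space p)"
      by (auto simp: Lp_space_def quotient_def T image_image Lp_rel_class)
  qed
  have "vnorm (Lp_space p) (T F) = vnorm image_space F"
    "T (vscale image_space a F) = vscale (Lp_space p) a (T F)"
    if F: "F \<in> vcarrier image_space" for F a
  proof -
    obtain f where f: "f \<in> Lp_functions p" "F = \<Phi> f" using F by auto
    show "vnorm (Lp_space p) (T F) = vnorm image_space F"
      using f by (simp add: T Lp_space_class image_norm_rep)
    show "T (vscale image_space a F) = vscale (Lp_space p) a (T F)"
      using f by (simp add: T Lp_space_class flip: rep_scale)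
  qed
  moreover have "T (vadd image_space F G) = vadd (Lp_space p) (T F) (T G)"
    if FG: "F \<in> vcarrier image_space" "G \<in> vcarrier image_space" for F G
  proof -
    obtain f g where "f \<in> Lp_functions p" "F = \<Phi> f" "g \<in> Lp_functions p" "G = \<Phi> g"
      using FG by auto
    then show ?thesis by (simp add: T Lp_space_class flip: rep_add)
  qed
  ultimately show ?thesis
    unfolding isometrically_isomorphic_def using bij by (intro exI[of _ T] conjI ballI allI)
qed

end

section \<open>The two image spaces\<close>

context admissible_exponent
begin

lemma Lp_function_weighted_L1:
  assumes f: "f \<in> Lp_functions p"
  shows "weighted_L1 f"
proof -
  note [measurable] = Lp_functions_measurable[OF f] ident_measurable_lebesgue
  obtain K where "(\<integral>\<^sup>+x. ennreal (cmod (f x) / (1 + \<bar>x\<bar>)) \<partial>lebesgue) \<le> ennreal (K * Lp_norm p f)"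
    using Lp_weighted_L1 f by metis
  then have "(\<integral>\<^sup>+x. ennreal (cmod (f x) / (1 + \<bar>x\<bar>)) \<partial>lebesgue) < \<infinity>"
    by (auto intro: le_less_trans)
  then show ?thesis
    using Lp_functions_measurable[OF f] unfolding weighted_L1_def
    by (auto intro!: integrableI_nonneg)
qed

text \<open>The bound involves only the first derivative of the test function and weights up to the third
  power, hence the double sum up to order 3 on the right.\<close>

lemma distributional_derivative_Psi_tempered:
  assumes f: "f \<in> Lp_functions p"
  shows "distributional_derivative (Psi f) \<in> tempered_distributions"
proof -
  note w = Lp_function_weighted_L1[OF f]
  note DD = distributional_derivative_Psi_eq(1)[OF w] and int = integrable_Psi_times_schwartz(1)[OF w]
  let ?T = "distributional_derivative (Psi f)"
  have add: "?T (\<lambda>x. \<phi> x + \<psi> x) = ?T \<phi> + ?T \<psi>"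
    if "\<phi> \<in> schwartz_functions" "\<psi> \<in> schwartz_functions" for \<phi> \<psi>
    using that
    by (simp add: DD schwartz_add nth_deriv_add distrib_left Bochner_Integration.integral_add int
        del: One_nat_def)
  have scale: "?T (\<lambda>x. a * \<phi> x) = a * ?T \<phi>" if "\<phi> \<in> schwartz_functions" for \<phi> a
    using that by (simp add: DD schwartz_scale nth_deriv_scale mult.left_commute[of _ a])
  obtain C where C: "0 \<le> C" "\<And>\<phi>. \<phi> \<in> schwartz_functions \<Longrightarrow>
      (LINT s|lborel. (1 + \<bar>s\<bar>) * cmod (nth_deriv 1 \<phi> s)) \<le> C * (\<Sum>j\<le>3. schwartz_seminorm j 1 \<phi>)"
    using schwartz_weighted_integral_le[of 1] by blast
  let ?W = "LINT t|lebesgue. cmod (f t) / (1 + \<bar>t\<bar>)"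
  have bound: "cmod (?T \<phi>) \<le> (2 * ?W * C) * (\<Sum>j\<le>3. \<Sum>k\<le>3. schwartz_seminorm j k \<phi>)"
    if \<phi>: "\<phi> \<in> schwartz_functions" for \<phi>
  proof -
    have "cmod (?T \<phi>) \<le> 2 * ?W * (LINT s|lborel. (1 + \<bar>s\<bar>) * cmod (nth_deriv 1 \<phi> s))"
      unfolding DD[OF \<phi>] norm_minus_cancel by (rule integrable_Psi_times_schwartz(2)[OF w \<phi>])
    also have "\<dots> \<le> 2 * ?W * (C * (\<Sum>j\<le>3. schwartz_seminorm j 1 \<phi>))"
      by (intro mult_left_mono C \<phi>) simp
    also have "\<dots> \<le> 2 * ?W * (C * (\<Sum>j\<le>3. \<Sum>k\<le>3. schwartz_seminorm j k \<phi>))"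
      using C(1) by (intro mult_left_mono sum_mono member_le_sum schwartz_seminorm_nonneg \<phi>) auto
    finally show ?thesis by (simp only: mult.assoc)
  qed
  have off: "?T \<phi> = 0" if "\<phi> \<notin> schwartz_functions" for \<phi>
    using that by (simp add: distributional_derivative_def)
  show ?thesis
    unfolding tempered_distributions_def using off add scale bound by blast
qed

text \<open>Since \<open>Psi f = 0\<close> implies that the distributional derivative vanishes, injectivity of the
  second map yields injectivity of the first.\<close>

lemma Psi_faithful: "faithful_representation p Psi"
  and distributional_derivative_Psi_faithful:
    "faithful_representation p (\<lambda>f. distributional_derivative (Psi f))"
proof -
  note w = Lp_function_weighted_L1
  have zero_dist: "distributional_derivative (\<lambda>s. 0) = (\<lambda>\<phi>. 0)"
    by (simp add: distributional_derivative_def fun_eq_iff)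
  have zero_Psi: "Psi f = (\<lambda>s. 0)" if "f \<in> Lp_functions p" "AE t in lebesgue. f t = 0" for f
  proof -
    have "Psi f = Psi (\<lambda>t. 0 * f t)"
      using that Lp_functions_measurable[OF that(1)] by (intro Psi_cong_AE) auto
    also have "\<dots> = (\<lambda>s. 0 * Psi f s)" by (rule Psi_scale)
    finally show ?thesis by simp
  qed
  have inj: "AE t in lebesgue. f t = 0"
    if "f \<in> Lp_functions p" "distributional_derivative (Psi f) = (\<lambda>\<phi>. 0)" for f
    using that by (intro distributional_derivative_Psi_zero_imp_AE_zero w) auto
  show "faithful_representation p Psi"
  proof
    show "Psi (\<lambda>t. f t + g t) = (\<lambda>x. Psi f x + Psi g x)" if "f \<in> Lp_functions p" "g \<in> Lp_functions p" for f g
      using that by (intro Psi_add w)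
    show "Psi (\<lambda>t. a * f t) = (\<lambda>x. a * Psi f x)" for f a by (rule Psi_scale)
    show "(Psi f = (\<lambda>x. 0)) = (AE t in lebesgue. f t = 0)" if "f \<in> Lp_functions p" for f
      using that inj zero_Psi zero_dist by metis
  qed
  show "faithful_representation p (\<lambda>f. distributional_derivative (Psi f))"
  proof
    fix f g assume fg: "f \<in> Lp_functions p" "g \<in> Lp_functions p"
    show "distributional_derivative (Psi (\<lambda>t. f t + g t))
      = (\<lambda>\<phi>. distributional_derivative (Psi f) \<phi> + distributional_derivative (Psi g) \<phi>)"
    proof
      fix \<phi>
      show "distributional_derivative (Psi (\<lambda>t. f t + g t)) \<phi>
        = distributional_derivative (Psi f) \<phi> + distributional_derivative (Psi g) \<phi>"
      proof (cases "\<phi> \<in> schwartz_functions")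
        case True
        have "(LINT s|lborel. Psi (\<lambda>t. f t + g t) s * nth_deriv 1 \<phi> s)
          = (LINT s|lborel. Psi f s * nth_deriv 1 \<phi> s + Psi g s * nth_deriv 1 \<phi> s)"
          by (simp only: Psi_add[OF w[OF fg(1)] w[OF fg(2)]] distrib_right)
        also have "\<dots> = (LINT s|lborel. Psi f s * nth_deriv 1 \<phi> s) + (LINT s|lborel. Psi g s * nth_deriv 1 \<phi> s)"
          by (intro Bochner_Integration.integral_add integrable_Psi_times_schwartz w fg True)
        finally show ?thesis
          using fg True by (simp add: distributional_derivative_Psi_eq w Lp_functions_add del: One_nat_def)
      qed (simp add: distributional_derivative_def)
    qed
  next
    fix f a
    show "distributional_derivative (Psi (\<lambda>t. a * f t)) = (\<lambda>\<phi>. a * distributional_derivative (Psi f) \<phi>)"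
      by (simp add: distributional_derivative_def Psi_scale fun_eq_iff mult.assoc)
  next
    fix f assume "f \<in> Lp_functions p"
    then show "(distributional_derivative (Psi f) = (\<lambda>x. 0)) = (AE t in lebesgue. f t = 0)"
      using inj zero_Psi zero_dist by metis
  qed
qed

end

theorem theorem4p1:
  fixes p :: "real \<Rightarrow> ennreal"
  assumes "p \<in> exponent_functions"
    and "esssup lebesgue p < \<infinity> \<or> log_Hoelder_at_infinity (\<lambda>x. enn2real (1 / p x)) 1"
  shows
    "((\<forall>f\<in>Lp_functions p. \<forall>s. s \<noteq> 0 \<longrightarrow> integrable lebesgue (Psi_integrand f s)) \<and>
      (\<forall>f\<in>Lp_functions p. vnorm (B_space p) (Psi f) = Lp_norm p f) \<and>
      complex_banach_space_on (B_space p) \<and>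
      isometrically_isomorphic (B_space p) (Lp_space p))
     \<and>
     ((\<forall>f\<in>Lp_functions p. \<forall>\<phi>\<in>schwartz_functions.
         integrable lebesgue (\<lambda>s. Psi f s * vector_derivative \<phi> (at s))) \<and>
      vcarrier (A_space p) \<subseteq> tempered_distributions \<and>
      (\<forall>f\<in>Lp_functions p.
         vnorm (A_space p) (distributional_derivative (Psi f)) = Lp_norm p f) \<and>
      complex_banach_space_on (A_space p) \<and>
      isometrically_isomorphic (A_space p) (Lp_space p))"
proof -
  interpret admissible_exponent p
    using assms by (simp add: admissible_exponent_def variable_exponent_def admissible_exponent_axioms_def)
  interpret B: faithful_representation p Psi by (rule Psi_faithful)
  interpret A: faithful_representation p "\<lambda>f. distributional_derivative (Psi f)"
    by (rule distributional_derivative_Psi_faithful)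
  have B: "B_space p = B.image_space"
    by (simp add: B_space_def B_norm_def[abs_def] B.image_norm_def[abs_def])
  have A: "A_space p = A.image_space"
    by (simp add: A_space_def A_norm_def[abs_def] A.image_norm_def[abs_def])
  show ?thesis
    unfolding A B
  proof (intro conjI ballI allI impI)
    fix f assume f: "f \<in> Lp_functions p"
    note w = Lp_function_weighted_L1[OF f]
    show "integrable lebesgue (Psi_integrand f s)" for s by (rule integrable_Psi_integrand[OF w])
    show "integrable lebesgue (\<lambda>s. Psi f s * vector_derivative \<phi> (at s))"
      if "\<phi> \<in> schwartz_functions" for \<phi>
      by (rule distributional_derivative_Psi_eq(2)[OF w that])
    show "vnorm B.image_space (Psi f) = Lp_norm p f"
      by (simp add: B.image_norm_rep f)
    show "vnorm A.image_space (distributional_derivative (Psi f)) = Lp_norm p f"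
      by (simp add: A.image_norm_rep f)
  next
    show "vcarrier A.image_space \<subseteq> tempered_distributions"
      using distributional_derivative_Psi_tempered by auto
  qed (rule B.image_space_banach A.image_space_banach B.image_space_isometric A.image_space_isometric)+
qed

end
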